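(* Let $\mathcal{C}$ be a congruence-modular equational class such that $[\nabla_M,\nabla_M]_M=\nabla_M$ for every algebra $M$ from $\mathcal{C}$. Let $n\geq 1$ be an integer, let $A_1,\ldots,A_n,B_1,\ldots,B_n$ be algebras from $\mathcal{C}$, let $f_i:A_i\to B_i$ be a morphism in $\mathcal{C}$ for each $i\in\{1,\ldots,n\}$, let $A=\prod_{i=1}^nA_i$, $B=\prod_{i=1}^nB_i$ and $f=\prod_{i=1}^nf_i:A\to B$ (defined componentwise). Then: (1) $f$ is admissible iff $f_1,\ldots,f_n$ are admissible; (2) if $f$ is admissible, then: $f$ fulfills GU iff $f_1,\ldots,f_n$ fulfill GU; (3) if $f$ is admissible, then: $f$ fulfills LO iff $f_1,\ldots,f_n$ fulfill LO.
   Context: An equational class (variety) $\mathcal{C}$ of algebras of a fixed type is congruence-modular if the congruence lattice $\mathrm{Con}(M)$ is modular for every member $M$ of $\mathcal{C}$. All algebras are non-empty; a morphism in $\mathcal{C}$ is a homomorphism between members of $\mathcal{C}$. For an algebra $M$, $\Delta_M$ is the equality relation and $\nabla_M=M^2$. In a congruence-modular class, the commutator $[\alpha,\beta]_M$ of $\alpha,\beta\in\mathrm{Con}(M)$ is the (Freese--McKenzie) modular commutator, i.e. the smallest congruence $\delta$ of $M$ such that, for every term $t(\bar x,\bar y)$ and all tuples $\bar a,\bar b,\bar c,\bar d$ of elements of $M$ with $(a_i,b_i)\in\alpha$ for all $i$ and $(c_j,d_j)\in\beta$ for all $j$, $(t(\bar a,\bar c),t(\bar a,\bar d))\in\delta$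 implies $(t(\bar b,\bar c),t(\bar b,\bar d))\in\delta$. It is known that the condition $[\nabla_M,\nabla_M]_M=\nabla_M$ for all $M$ in $\mathcal{C}$ is equivalent to: $[\theta,\nabla_M]_M=\theta$ for all $M$ in $\mathcal{C}$ and $\theta\in\mathrm{Con}(M)$; and also to: for all $n\geq1$ and $M_1,\ldots,M_n$ in $\mathcal{C}$, every congruence of $\prod_{i=1}^nM_i$ is of the form $\prod_{i=1}^n\theta_i=\{((x_i)_i,(y_i)_i) : (x_i,y_i)\in\theta_i \text{ for all } i\}$ with $\theta_i\in\mathrm{Con}(M_i)$; it holds if $\mathcal{C}$ is semi-degenerate (no non-trivial algebra in $\mathcal{C}$ has a one-element subalgebra) or congruence-distributive. A congruence $\phi\neq\nabla_M$ is prime if, for all $\alpha,\beta\in\mathrm{Con}(M)$, $[\alpha,\beta]_M\subseteq\phi$ implies $\alpha\subseteq\phi$ or $\beta\subseteq\phi$; $\mathrm{Spec}(M)$ is the set of prime congruences of $M$. For a morphism $g:P\to Q$ in $\mathcal{C}$ and $\psi\in\mathrm{Con}(Q)$, $g^*(\psi)=\{(x,y)\in P^2 : (g(x),g(y))\in\psi\}\in\mathrm{Con}(P)$ and $\mathrm{Ker}(g)=g^*(\Delta_Q)$. The morphism $g$ is admissible if $g^*(\psi)\in\mathrm{Spec}(P)$ for all $\psi\in\mathrm{Spec}(Q)$. An admissible morphism $g:P\to Q$ fulfills GU (Going Up) if for all $\phi,\psi\in\mathrm{Spec}(P)$ and $\phi_1\in\mathrm{Spec}(Q)$ with $\phi\subseteq\psi$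 and $g^*(\phi_1)=\phi$ there is $\psi_1\in\mathrm{Spec}(Q)$ with $\phi_1\subseteq\psi_1$ and $g^*(\psi_1)=\psi$; it fulfills LO (Lying Over) if for every $\phi\in\mathrm{Spec}(P)$ with $\mathrm{Ker}(g)\subseteq\phi$ there is $\phi_1\in\mathrm{Spec}(Q)$ with $g^*(\phi_1)=\phi$. *)

theory Defs
  imports "HOL-Library.FuncSet"
begin

text \<open>
  A type of algebras (signature) is a partial map from symbols to arities: its domain is the set of
  operation symbols.  Term formation is guarded by \<open>wf_trm\<close>, as the datatype itself ignores arities.
\<close>

type_synonym 'f signature = "'f \<rightharpoonup> nat"

datatype ('f, 'v) trm = Var 'v | App 'f "('f, 'v) trm list"

fun wf_trm :: "'f signature \<Rightarrow> ('f, 'v) trm \<Rightarrow> bool" where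
  "wf_trm \<Sigma> (Var x) \<longleftrightarrow> True"
| "wf_trm \<Sigma> (App f ts) \<longleftrightarrow> \<Sigma> f = Some (length ts) \<and> (\<forall>t\<in>set ts. wf_trm \<Sigma> t)"

record ('f, 'a) algebra =
  carrier :: "'a set"
  oper :: "'f \<Rightarrow> 'a list \<Rightarrow> 'a"

fun eval_trm :: "('f, 'a) algebra \<Rightarrow> ('v \<Rightarrow> 'a) \<Rightarrow> ('f, 'v) trm \<Rightarrow> 'a" where
  "eval_trm M \<rho> (Var x) = \<rho> x"
| "eval_trm M \<rho> (App f ts) = oper M f (map (eval_trm M \<rho>) ts)"

definition is_algebra :: "'f signature \<Rightarrow> ('f, 'a) algebra \<Rightarrow> bool" where
  "is_algebra \<Sigma> M \<longleftrightarrow> carrier M \<noteq> {} \<and>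
     (\<forall>f as. \<Sigma> f = Some (length as) \<and> set as \<subseteq> carrier M \<longrightarrow> oper M f as \<in> carrier M)"

type_synonym 'f equations = "(('f, nat) trm \<times> ('f, nat) trm) set"

definition wf_equations :: "'f signature \<Rightarrow> 'f equations \<Rightarrow> bool" where
  "wf_equations \<Sigma> E \<longleftrightarrow> (\<forall>(s, t)\<in>E. wf_trm \<Sigma> s \<and> wf_trm \<Sigma> t)"

text \<open>
  The equational class axiomatised by \<open>E\<close>.  It is polymorphic in the type holding the carriers, so
  the same \<open>\<Sigma>\<close> and \<open>E\<close> describe the class at all carrier types.
\<close>

definition equational_class :: "'f signature \<Rightarrow> 'f equations \<Rightarrow> ('f, 'a) algebra set" where
  "equational_class \<Sigma> E = {M. is_algebra \<Sigma> M \<and>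
     (\<forall>(s, t)\<in>E. \<forall>\<rho>. range \<rho> \<subseteq> carrier M \<longrightarrow> eval_trm M \<rho> s = eval_trm M \<rho> t)}"

text \<open>
  HOL cannot quantify over carrier types inside a hypothesis, so a condition on ``every algebra of
  the class'' is imposed on all algebras whose carrier is a subset of the following type.  For
  the two conditions used (modularity of all congruence lattices, and perfectness of all algebras
  with respect to the commutator) this amounts to imposing them at every carrier type.  Modularity
  holds throughout the class iff it holds for the free algebra on four generators (Day), which has
  an isomorphic copy here: choose a representative term in each class.  If modularity holds and
  \<open>[\<nabla>, \<nabla>] \<noteq> \<nabla>\<close> in some \<open>M\<close>, then \<open>M / [\<nabla>, \<nabla>]\<close> is abelian and
  has a nontrivial two-generated subalgebra; this is abelian too and again has a copy here.  The
  variables of types \<open>'a\<close> and \<open>'b\<close> put copies of all algebras over \<open>'a\<close> and \<open>'b\<close>, and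
  of their finite products, into the range of quantification as well.
\<close>

type_synonym ('f, 'a, 'b) universe = "('f, nat + 'a + 'b) trm"

definition Con :: "'f signature \<Rightarrow> ('f, 'a) algebra \<Rightarrow> 'a rel set" where
  "Con \<Sigma> M = {\<theta>. equiv (carrier M) \<theta> \<and>
     (\<forall>f as bs. \<Sigma> f = Some (length as) \<and> list_all2 (\<lambda>x y. (x, y) \<in> \<theta>) as bs
        \<longrightarrow> (oper M f as, oper M f bs) \<in> \<theta>)}"

definition nabla :: "('f, 'a) algebra \<Rightarrow> 'a rel" where
  "nabla M = carrier M \<times> carrier M"

definition con_join :: "'f signature \<Rightarrow> ('f, 'a) algebra \<Rightarrow> 'a rel \<Rightarrow> 'a rel \<Rightarrow> 'a rel" where
  "con_join \<Sigma> M \<alpha> \<beta> = \<Inter>{\<theta> \<in> Con \<Sigma> M. \<alpha> \<union> \<beta> \<subseteq> \<theta>}"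

text \<open>Meets in the congruence lattice are intersections.\<close>

definition Con_modular :: "'f signature \<Rightarrow> ('f, 'a) algebra \<Rightarrow> bool" where
  "Con_modular \<Sigma> M \<longleftrightarrow> (\<forall>\<alpha>\<in>Con \<Sigma> M. \<forall>\<beta>\<in>Con \<Sigma> M. \<forall>\<gamma>\<in>Con \<Sigma> M.
     \<alpha> \<subseteq> \<gamma> \<longrightarrow> con_join \<Sigma> M \<alpha> (\<beta> \<inter> \<gamma>) = con_join \<Sigma> M \<alpha> \<beta> \<inter> \<gamma>)"

text \<open>
  In \<open>t(x, y)\<close> the variables \<open>Inl i\<close> form the tuple \<open>x\<close> and the variables \<open>Inr j\<close> the tuple \<open>y\<close>.  The
  tuples of elements are infinite sequences, of which a term uses only finitely many entries.
\<close>

definition centralizes ::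
    "'f signature \<Rightarrow> ('f, 'a) algebra \<Rightarrow> 'a rel \<Rightarrow> 'a rel \<Rightarrow> 'a rel \<Rightarrow> bool" where
  "centralizes \<Sigma> M \<alpha> \<beta> \<delta> \<longleftrightarrow>
     (\<forall>(t :: ('f, nat + nat) trm) (a :: nat \<Rightarrow> 'a) b c d.
        wf_trm \<Sigma> t \<and> (\<forall>i. (a i, b i) \<in> \<alpha>) \<and> (\<forall>j. (c j, d j) \<in> \<beta>) \<and>
        (eval_trm M (case_sum a c) t, eval_trm M (case_sum a d) t) \<in> \<delta>
        \<longrightarrow> (eval_trm M (case_sum b c) t, eval_trm M (case_sum b d) t) \<in> \<delta>)"

text \<open>
  \<open>centralizes \<Sigma> M \<alpha> \<beta> \<delta>\<close> is preserved by intersections in \<open>\<delta>\<close> and holds for \<open>\<delta> = \<nabla>\<close>, so the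
  intersection below is the smallest congruence with this property.
\<close>

definition commutator ::
    "'f signature \<Rightarrow> ('f, 'a) algebra \<Rightarrow> 'a rel \<Rightarrow> 'a rel \<Rightarrow> 'a rel" where
  "commutator \<Sigma> M \<alpha> \<beta> = \<Inter>{\<delta> \<in> Con \<Sigma> M. centralizes \<Sigma> M \<alpha> \<beta> \<delta>}"

definition Spec :: "'f signature \<Rightarrow> ('f, 'a) algebra \<Rightarrow> 'a rel set" where
  "Spec \<Sigma> M = {\<phi> \<in> Con \<Sigma> M. \<phi> \<noteq> nabla M \<and>
     (\<forall>\<alpha>\<in>Con \<Sigma> M. \<forall>\<beta>\<in>Con \<Sigma> M. commutator \<Sigma> M \<alpha> \<beta> \<subseteq> \<phi> \<longrightarrow> \<alpha> \<subseteq> \<phi> \<or> \<beta> \<subseteq> \<phi>)}"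

definition morphism ::
    "'f signature \<Rightarrow> ('f, 'a) algebra \<Rightarrow> ('f, 'b) algebra \<Rightarrow> ('a \<Rightarrow> 'b) \<Rightarrow> bool" where
  "morphism \<Sigma> P Q g \<longleftrightarrow> g \<in> carrier P \<rightarrow> carrier Q \<and>
     (\<forall>f as. \<Sigma> f = Some (length as) \<and> set as \<subseteq> carrier P
        \<longrightarrow> g (oper P f as) = oper Q f (map g as))"

definition pullback :: "('f, 'a) algebra \<Rightarrow> ('a \<Rightarrow> 'b) \<Rightarrow> 'b rel \<Rightarrow> 'a rel" where
  "pullback P g \<psi> = {(x, y). x \<in> carrier P \<and> y \<in> carrier P \<and> (g x, g y) \<in> \<psi>}"

definition Ker :: "('f, 'a) algebra \<Rightarrow> ('f, 'b) algebra \<Rightarrow> ('a \<Rightarrow> 'b) \<Rightarrow> 'a rel" where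
  "Ker P Q g = pullback P g (Id_on (carrier Q))"

definition admissible ::
    "'f signature \<Rightarrow> ('f, 'a) algebra \<Rightarrow> ('f, 'b) algebra \<Rightarrow> ('a \<Rightarrow> 'b) \<Rightarrow> bool" where
  "admissible \<Sigma> P Q g \<longleftrightarrow> (\<forall>\<psi>\<in>Spec \<Sigma> Q. pullback P g \<psi> \<in> Spec \<Sigma> P)"

definition going_up ::
    "'f signature \<Rightarrow> ('f, 'a) algebra \<Rightarrow> ('f, 'b) algebra \<Rightarrow> ('a \<Rightarrow> 'b) \<Rightarrow> bool" where
  "going_up \<Sigma> P Q g \<longleftrightarrow>
     (\<forall>\<phi>\<in>Spec \<Sigma> P. \<forall>\<psi>\<in>Spec \<Sigma> P. \<forall>\<phi>\<^sub>1\<in>Spec \<Sigma> Q. \<phi> \<subseteq> \<psi> \<and> pullback P g \<phi>\<^sub>1 = \<phi>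
        \<longrightarrow> (\<exists>\<psi>\<^sub>1\<in>Spec \<Sigma> Q. \<phi>\<^sub>1 \<subseteq> \<psi>\<^sub>1 \<and> pullback P g \<psi>\<^sub>1 = \<psi>))"

definition lying_over ::
    "'f signature \<Rightarrow> ('f, 'a) algebra \<Rightarrow> ('f, 'b) algebra \<Rightarrow> ('a \<Rightarrow> 'b) \<Rightarrow> bool" where
  "lying_over \<Sigma> P Q g \<longleftrightarrow>
     (\<forall>\<phi>\<in>Spec \<Sigma> P. Ker P Q g \<subseteq> \<phi> \<longrightarrow> (\<exists>\<phi>\<^sub>1\<in>Spec \<Sigma> Q. pullback P g \<phi>\<^sub>1 = \<phi>))"

definition prod_algebra :: "'i set \<Rightarrow> ('i \<Rightarrow> ('f, 'a) algebra) \<Rightarrow> ('f, 'i \<Rightarrow> 'a) algebra" where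
  "prod_algebra I M = \<lparr>carrier = (\<Pi>\<^sub>E i\<in>I. carrier (M i)),
     oper = (\<lambda>f xs. \<lambda>i\<in>I. oper (M i) f (map (\<lambda>x. x i) xs))\<rparr>"

definition prod_map :: "'i set \<Rightarrow> ('i \<Rightarrow> 'a \<Rightarrow> 'b) \<Rightarrow> ('i \<Rightarrow> 'a) \<Rightarrow> ('i \<Rightarrow> 'b)" where
  "prod_map I g x = (\<lambda>i\<in>I. g i (x i))"

end

theory Submission
  imports Defs "HOL-Library.Nat_Bijection"
begin

text \<open>
  The heart of the matter is that a finite product of algebras of the class has no skew congruences.
  The term condition defining the commutator passes to the closure of a set of matrices, and Gumm's
  shifting lemma, obtained from modularity in subalgebras of squares, makes it symmetric in its two
  congruences. If \<open>\<theta>\<close> is central modulo \<open>\<delta>\<close>, then \<open>\<theta>\<close>, as an algebra, has an abelian quotient that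
  identifies the diagonal; perfectness trivialises this quotient, whence \<open>\<theta> \<subseteq> \<delta>\<close>. For a pair of
  complementary factor congruences this is applied to the congruence \<open>\<delta>\<close> of all pairs along which \<open>\<theta>\<close> can be
  projected, and it follows that congruences of a product are compatible with the projections.

  Hence commutators of a product are computed in the factors. Since the commutator lies below the
  meet, a prime congruence of a finite product contains the kernel of some projection, so that the primes of
  the product are exactly the preimages of the primes of the factors, for a unique factor. Preimages
  under \<open>\<Prod> f\<^sub>i\<close> respect this description, and so each of the three properties splits.
\<close>

section \<open>Congruences, morphisms and equational classes\<close>

lemma ConI:
  assumes "\<theta> \<subseteq> carrier M \<times> carrier M"
    and "\<And>x. x \<in> carrier M \<Longrightarrow> (x, x) \<in> \<theta>"
    and "\<And>x y. (x, y) \<in> \<theta> \<Longrightarrow> (y, x) \<in> \<theta>"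
    and "\<And>x y z. (x, y) \<in> \<theta> \<Longrightarrow> (y, z) \<in> \<theta> \<Longrightarrow> (x, z) \<in> \<theta>"
    and "\<And>g as bs. \<Sigma> g = Some (length as) \<Longrightarrow> list_all2 (\<lambda>x y. (x, y) \<in> \<theta>) as bs
          \<Longrightarrow> (oper M g as, oper M g bs) \<in> \<theta>"
  shows "\<theta> \<in> Con \<Sigma> M"
  unfolding Con_def equiv_def refl_on_def sym_def trans_def using assms by blast

lemma Con_carrier: "\<theta> \<in> Con \<Sigma> M \<Longrightarrow> \<theta> \<subseteq> carrier M \<times> carrier M"
  by (auto simp: Con_def equiv_def)

lemma Con_carrierD:
  assumes "\<theta> \<in> Con \<Sigma> M" "(x, y) \<in> \<theta>"
  shows "x \<in> carrier M" "y \<in> carrier M"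
  using Con_carrier[OF assms(1)] assms(2) by auto

lemma Con_refl: "\<theta> \<in> Con \<Sigma> M \<Longrightarrow> x \<in> carrier M \<Longrightarrow> (x, x) \<in> \<theta>"
  by (auto simp: Con_def equiv_def refl_on_def)

lemma Con_sym: "\<theta> \<in> Con \<Sigma> M \<Longrightarrow> (x, y) \<in> \<theta> \<Longrightarrow> (y, x) \<in> \<theta>"
  by (auto simp: Con_def equiv_def sym_def)

lemma Con_trans: "\<theta> \<in> Con \<Sigma> M \<Longrightarrow> (x, y) \<in> \<theta> \<Longrightarrow> (y, z) \<in> \<theta> \<Longrightarrow> (x, z) \<in> \<theta>"
  unfolding Con_def equiv_def trans_def by blast

lemma Con_oper:
  "\<theta> \<in> Con \<Sigma> M \<Longrightarrow> \<Sigma> g = Some (length as) \<Longrightarrow> list_all2 (\<lambda>x y. (x, y) \<in> \<theta>) as bs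
    \<Longrightarrow> (oper M g as, oper M g bs) \<in> \<theta>"
  by (simp add: Con_def)

lemma is_algebra_oper:
  "is_algebra \<Sigma> M \<Longrightarrow> \<Sigma> g = Some (length as) \<Longrightarrow> set as \<subseteq> carrier M \<Longrightarrow> oper M g as \<in> carrier M"
  by (simp add: is_algebra_def)

lemma list_all2_conj:
  "list_all2 (\<lambda>x y. P x y \<and> Q x y) xs ys \<longleftrightarrow> list_all2 P xs ys \<and> list_all2 Q xs ys"
  by (auto simp: list_all2_conv_all_nth)

lemma list_all2_subset_carrier:
  assumes "list_all2 (\<lambda>x y. (x, y) \<in> \<theta>) as bs" "\<theta> \<subseteq> A \<times> B"
  shows "set as \<subseteq> A" "set bs \<subseteq> B"
  using assms by (induction rule: list_all2_induct) auto

lemma Con_Int: "\<alpha> \<in> Con \<Sigma> M \<Longrightarrow> \<beta> \<in> Con \<Sigma> M \<Longrightarrow> \<alpha> \<inter> \<beta> \<in> Con \<Sigma> M"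
  by (rule ConI)
    (auto simp: list_all2_conj dest: Con_carrier intro: Con_refl Con_sym Con_trans Con_oper)

lemma Con_Inter:
  assumes "S \<noteq> {}" "S \<subseteq> Con \<Sigma> M"
  shows "\<Inter>S \<in> Con \<Sigma> M"
proof (rule ConI)
  show "\<Inter>S \<subseteq> carrier M \<times> carrier M"
    using assms Con_carrier by blast
  fix g as bs
  assume g: "\<Sigma> g = Some (length as)" and l: "list_all2 (\<lambda>x y. (x, y) \<in> \<Inter>S) as bs"
  show "(oper M g as, oper M g bs) \<in> \<Inter>S"
  proof
    fix \<theta> assume "\<theta> \<in> S"
    moreover from this have "list_all2 (\<lambda>x y. (x, y) \<in> \<theta>) as bs"
      using list_all2_mono[OF l, of "\<lambda>x y. (x, y) \<in> \<theta>"] by blast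
    ultimately show "(oper M g as, oper M g bs) \<in> \<theta>"
      using assms(2) g by (auto intro: Con_oper)
  qed
qed (use assms(2) in \<open>blast intro: Con_refl Con_sym Con_trans\<close>)+

lemma Con_nabla: "is_algebra \<Sigma> M \<Longrightarrow> nabla M \<in> Con \<Sigma> M"
  unfolding nabla_def
proof (rule ConI)
  fix g as bs
  assume M: "is_algebra \<Sigma> M" and g: "\<Sigma> g = Some (length as)"
    and l: "list_all2 (\<lambda>x y. (x, y) \<in> carrier M \<times> carrier M) as bs"
  then show "(oper M g as, oper M g bs) \<in> carrier M \<times> carrier M"
    using list_all2_subset_carrier[OF l subset_refl] list_all2_lengthD[OF l]
    by (auto intro: is_algebra_oper)
qed auto

lemma Con_Id_on: "is_algebra \<Sigma> M \<Longrightarrow> Id_on (carrier M) \<in> Con \<Sigma> M"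
proof (rule ConI)
  fix g as bs
  assume M: "is_algebra \<Sigma> M" and g: "\<Sigma> g = Some (length as)"
    and l: "list_all2 (\<lambda>x y. (x, y) \<in> Id_on (carrier M)) as bs"
  have "as = bs"
    using l by (induction rule: list_all2_induct) auto
  moreover have "set as \<subseteq> carrier M"
    using list_all2_subset_carrier(1)[OF l, of "carrier M" "carrier M"] by auto
  ultimately show "(oper M g as, oper M g bs) \<in> Id_on (carrier M)"
    using is_algebra_oper[OF M g] by auto
qed auto

section \<open>Homomorphisms, preimages of congruences and evaluation of terms\<close>

lemma morphism_oper:
  "morphism \<Sigma> P Q h \<Longrightarrow> \<Sigma> g = Some (length as) \<Longrightarrow> set as \<subseteq> carrier P
    \<Longrightarrow> h (oper P g as) = oper Q g (map h as)"
  by (simp add: morphism_def)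

lemma morphism_carrier: "morphism \<Sigma> P Q h \<Longrightarrow> x \<in> carrier P \<Longrightarrow> h x \<in> carrier Q"
  by (auto simp: morphism_def)

lemma pullback_iff:
  "(x, y) \<in> pullback P h \<psi> \<longleftrightarrow> x \<in> carrier P \<and> y \<in> carrier P \<and> (h x, h y) \<in> \<psi>"
  by (simp add: pullback_def)

lemma Con_pullback:
  assumes P: "is_algebra \<Sigma> P" and h: "morphism \<Sigma> P Q h" and \<psi>: "\<psi> \<in> Con \<Sigma> Q"
  shows "pullback P h \<psi> \<in> Con \<Sigma> P"
proof (rule ConI)
  fix g as bs
  assume g: "\<Sigma> g = Some (length as)" and l: "list_all2 (\<lambda>x y. (x, y) \<in> pullback P h \<psi>) as bs"
  have s: "set as \<subseteq> carrier P" "set bs \<subseteq> carrier P"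
    using list_all2_subset_carrier[OF l, of "carrier P" "carrier P"]
    by (simp_all add: pullback_def subset_iff)
  have len: "length as = length bs"
    using l by (rule list_all2_lengthD)
  have "list_all2 (\<lambda>x y. (x, y) \<in> \<psi>) (map h as) (map h bs)"
    using l by (auto simp: list_all2_conv_all_nth pullback_iff)
  then have "(oper Q g (map h as), oper Q g (map h bs)) \<in> \<psi>"
    using \<psi> g by (auto intro: Con_oper)
  then show "(oper P g as, oper P g bs) \<in> pullback P h \<psi>"
    using g len s h P by (auto simp: pullback_iff morphism_oper intro!: is_algebra_oper)
qed (use \<psi> h in \<open>auto simp: pullback_iff intro: Con_refl Con_sym Con_trans morphism_carrier\<close>)

lemma eval_trm_carrier:
  assumes "is_algebra \<Sigma> M" "range \<rho> \<subseteq> carrier M" "wf_trm \<Sigma> t"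
  shows "eval_trm M \<rho> t \<in> carrier M"
  using assms(3)
proof (induction t)
  case (App g ts)
  then show ?case
    using assms(1) by (auto intro!: is_algebra_oper)
qed (use assms in auto)

lemma eval_trm_morphism:
  assumes "is_algebra \<Sigma> P" "morphism \<Sigma> P Q h" "range \<rho> \<subseteq> carrier P" "wf_trm \<Sigma> t"
  shows "h (eval_trm P \<rho> t) = eval_trm Q (h \<circ> \<rho>) t"
  using assms(4)
proof (induction t)
  case (App g ts)
  have "set (map (eval_trm P \<rho>) ts) \<subseteq> carrier P"
    using App.prems assms by (auto intro!: eval_trm_carrier)
  then have "h (oper P g (map (eval_trm P \<rho>) ts)) = oper Q g (map h (map (eval_trm P \<rho>) ts))"
    using App.prems by (intro morphism_oper[OF assms(2)]) auto
  also have "map h (map (eval_trm P \<rho>) ts) = map (eval_trm Q (h \<circ> \<rho>)) ts"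
    using App by (simp add: comp_def)
  finally show ?case
    by (simp only: eval_trm.simps)
qed simp

lemma equational_class_is_algebra: "M \<in> equational_class \<Sigma> E \<Longrightarrow> is_algebra \<Sigma> M"
  by (simp add: equational_class_def)

text \<open>Both sides of an equation have equal images under every \<open>h i\<close>, and the maps
  \<open>h i\<close> together separate points. This one criterion serves isomorphic copies, algebras
  of pairs and products alike.\<close>

lemma equational_class_jointly_injective:
  assumes "wf_equations \<Sigma> E" "is_algebra \<Sigma> P"
    and h: "\<And>i. i \<in> I \<Longrightarrow> morphism \<Sigma> P (Q i) (h i)"
    and Q: "\<And>i. i \<in> I \<Longrightarrow> Q i \<in> equational_class \<Sigma> E"
    and inj: "\<And>x y. x \<in> carrier P \<Longrightarrow> y \<in> carrier P \<Longrightarrow> (\<And>i. i \<in> I \<Longrightarrow> h i x = h i y) \<Longrightarrow> x = y"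
  shows "P \<in> equational_class \<Sigma> E"
proof -
  have "eval_trm P \<rho> s = eval_trm P \<rho> t" if st: "(s, t) \<in> E" and \<rho>: "range \<rho> \<subseteq> carrier P" for s t \<rho>
  proof (rule inj)
    have wf: "wf_trm \<Sigma> s" "wf_trm \<Sigma> t"
      using assms(1) st by (auto simp: wf_equations_def)
    show "eval_trm P \<rho> s \<in> carrier P" "eval_trm P \<rho> t \<in> carrier P"
      using wf assms(2) \<rho> by (auto intro: eval_trm_carrier)
    fix i assume i: "i \<in> I"
    have "range (h i \<circ> \<rho>) \<subseteq> carrier (Q i)"
      using \<rho> morphism_carrier[OF h[OF i]] by auto
    then show "h i (eval_trm P \<rho> s) = h i (eval_trm P \<rho> t)"
      using Q[OF i] st wf \<rho> by (auto simp: eval_trm_morphism[OF assms(2) h[OF i]] equational_class_def)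
  qed
  then show ?thesis
    using assms(2) by (auto simp: equational_class_def)
qed

section \<open>Centrality\<close>

definition pair_oper :: "('f, 'a) algebra \<Rightarrow> 'f \<Rightarrow> ('a \<times> 'a) list \<Rightarrow> 'a \<times> 'a" where
  "pair_oper M g xs = (oper M g (map fst xs), oper M g (map snd xs))"

text \<open>For a congruence \<theta> this is \<theta> viewed as a subalgebra of the square of
  \<open>M\<close>.\<close>

definition pair_algebra :: "('f, 'a) algebra \<Rightarrow> 'a rel \<Rightarrow> ('f, 'a \<times> 'a) algebra" where
  "pair_algebra M \<theta> = \<lparr>carrier = \<theta>, oper = pair_oper M\<rparr>"

lemma pair_algebra_simps [simp]:
  "carrier (pair_algebra M \<theta>) = \<theta>" "oper (pair_algebra M \<theta>) = pair_oper M"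
  by (simp_all add: pair_algebra_def)

text \<open>\<open>mat \<Sigma> M \<alpha> \<beta> (p, q) (r, s)\<close> says that \<open>p = t(a, c)\<close>, \<open>q = t(a, d)\<close>, \<open>r = t(b, c)\<close>,
  \<open>s = t(b, d)\<close> for some term \<open>t\<close>, tuples \<open>a \<alpha> b\<close> and \<open>c \<beta> d\<close>.\<close>

inductive mat :: "'f signature \<Rightarrow> ('f, 'a) algebra \<Rightarrow> 'a rel \<Rightarrow> 'a rel \<Rightarrow> 'a \<times> 'a \<Rightarrow> 'a \<times> 'a \<Rightarrow> bool"
  for \<Sigma> M \<alpha> \<beta> where
  left: "(x, y) \<in> \<alpha> \<Longrightarrow> mat \<Sigma> M \<alpha> \<beta> (x, x) (y, y)"
| right: "(x, y) \<in> \<beta> \<Longrightarrow> mat \<Sigma> M \<alpha> \<beta> (x, y) (x, y)"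
| oper: "\<Sigma> g = Some (length us) \<Longrightarrow> list_all2 (mat \<Sigma> M \<alpha> \<beta>) us vs
    \<Longrightarrow> mat \<Sigma> M \<alpha> \<beta> (pair_oper M g us) (pair_oper M g vs)"

lemma wf_trm_map_trm: "wf_trm \<Sigma> (map_trm id h t) \<longleftrightarrow> wf_trm \<Sigma> t"
  by (induction t) auto

lemma eval_trm_map_trm: "eval_trm M \<rho> (map_trm id h t) = eval_trm M (\<rho> \<circ> h) t"
proof (induction t)
  case (App g ts)
  then have "map (eval_trm M \<rho>) (map (map_trm id h) ts) = map (eval_trm M (\<rho> \<circ> h)) ts"
    by (simp add: id_def comp_def)
  then show ?case
    by (simp only: trm.map eval_trm.simps id_def)
qed simp

text \<open>The rules of \<open>mat\<close> follow the construction of \<open>t\<close>. Together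
  with the converse \<open>mat_trm\<close>, this replaces computations with terms by inductions on
  matrices.\<close>

lemma mat_eval_trm:
  assumes "wf_trm \<Sigma> t" "\<And>i. (a i, b i) \<in> \<alpha>" "\<And>j. (c j, d j) \<in> \<beta>"
  shows "mat \<Sigma> M \<alpha> \<beta> (eval_trm M (case_sum a c) t, eval_trm M (case_sum a d) t)
    (eval_trm M (case_sum b c) t, eval_trm M (case_sum b d) t)"
  using assms(1)
proof (induction t)
  case (Var x)
  then show ?case
    using assms by (cases x) (auto intro: mat.intros)
next
  case (App g ts)
  let ?us = "map (\<lambda>t. (eval_trm M (case_sum a c) t, eval_trm M (case_sum a d) t)) ts"
  let ?vs = "map (\<lambda>t. (eval_trm M (case_sum b c) t, eval_trm M (case_sum b d) t)) ts"
  have "list_all2 (mat \<Sigma> M \<alpha> \<beta>) ?us ?vs"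
    using App by (auto simp: list_all2_conv_all_nth)
  then have "mat \<Sigma> M \<alpha> \<beta> (pair_oper M g ?us) (pair_oper M g ?vs)"
    using App.prems by (intro mat.oper) auto
  then show ?case
    by (simp add: pair_oper_def comp_def)
qed

text \<open>An operation step merges the terms of its arguments into one, once their variables are
  renamed apart. The relations must be non-empty because the tuples are infinite sequences, with
  entries also at variables that do not occur.\<close>

lemma mat_trm:
  assumes "mat \<Sigma> M \<alpha> \<beta> u v" "\<alpha> \<noteq> {}" "\<beta> \<noteq> {}"
  shows "\<exists>(t :: ('f, nat + nat) trm) a b c d. wf_trm \<Sigma> t \<and> (\<forall>i. (a i, b i) \<in> \<alpha>) \<and> (\<forall>j. (c j, d j) \<in> \<beta>) \<and>
    u = (eval_trm M (case_sum a c) t, eval_trm M (case_sum a d) t) \<and>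
    v = (eval_trm M (case_sum b c) t, eval_trm M (case_sum b d) t)"
  using assms(1)
proof (induction rule: mat.induct)
  case (left x y)
  obtain c d where "(c, d) \<in> \<beta>"
    using assms(3) by auto
  with left show ?case
    by (intro exI[of _ "Var (Inl 0)"] exI[of _ "\<lambda>_. x"] exI[of _ "\<lambda>_. y"] exI[of _ "\<lambda>_. c"]
        exI[of _ "\<lambda>_. d"]) auto
next
  case (right x y)
  obtain a b where "(a, b) \<in> \<alpha>"
    using assms(2) by auto
  with right show ?case
    by (intro exI[of _ "Var (Inr 0)"] exI[of _ "\<lambda>_. a"] exI[of _ "\<lambda>_. b"] exI[of _ "\<lambda>_. x"]
        exI[of _ "\<lambda>_. y"]) auto
next
  case (oper g us vs)
  \<comment> \<open>Default pairs for the blocks numbered \<open>length us\<close> and higher, which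
    belong to no argument.\<close>
  obtain a0 b0 c0 d0 where def: "(a0, b0) \<in> \<alpha>" "(c0, d0) \<in> \<beta>"
    using assms(2,3) by auto
  have len: "length us = length vs"
    using oper by (auto dest: list_all2_lengthD)
  define Q where "Q = (\<lambda>k (t :: ('f, nat + nat) trm) a b c d. wf_trm \<Sigma> t \<and> (\<forall>i. (a i, b i) \<in> \<alpha>) \<and>
    (\<forall>j. (c j, d j) \<in> \<beta>) \<and> us ! k = (eval_trm M (case_sum a c) t, eval_trm M (case_sum a d) t) \<and>
    vs ! k = (eval_trm M (case_sum b c) t, eval_trm M (case_sum b d) t))"
  have "\<forall>k. \<exists>t a b c d. k < length us \<longrightarrow> Q k t a b c d"
    using oper(2) unfolding Q_def list_all2_conv_all_nth by blast
  then obtain t a b c d where Q: "\<And>k. k < length us \<Longrightarrow> Q k (t k) (a k) (b k) (c k) (d k)"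
    by metis
  define A where "A = (\<lambda>m. case prod_decode m of (k, i) \<Rightarrow> if k < length us then a k i else a0)"
  define B where "B = (\<lambda>m. case prod_decode m of (k, i) \<Rightarrow> if k < length us then b k i else b0)"
  define C where "C = (\<lambda>m. case prod_decode m of (k, i) \<Rightarrow> if k < length us then c k i else c0)"
  define D where "D = (\<lambda>m. case prod_decode m of (k, i) \<Rightarrow> if k < length us then d k i else d0)"
  \<comment> \<open>Variable \<open>i\<close> of the \<open>k\<close>-th argument moves to the
    position coding \<open>(k, i)\<close>. Composed with \<open>h k\<close>, the joint sequences
    \<open>A\<close>, \<open>B\<close>, \<open>C\<close>, \<open>D\<close> therefore become the
    sequences of the \<open>k\<close>-th argument.\<close>
  define h where "h = (\<lambda>k. map_sum (\<lambda>i. prod_encode (k, i)) (\<lambda>i :: nat. prod_encode (k, i)))"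
  define ts where "ts = map (\<lambda>k. map_trm id (h k) (t k)) [0..<length us]"
  have h: "case_sum A C \<circ> h k = case_sum (a k) (c k)" "case_sum A D \<circ> h k = case_sum (a k) (d k)"
     "case_sum B C \<circ> h k = case_sum (b k) (c k)" "case_sum B D \<circ> h k = case_sum (b k) (d k)"
    if "k < length us" for k
    using that by (auto simp: h_def A_def B_def C_def D_def fun_eq_iff split: sum.splits)
  have AB: "\<forall>i. (A i, B i) \<in> \<alpha>" "\<forall>j. (C j, D j) \<in> \<beta>"
    using Q def by (auto simp: A_def B_def C_def D_def Q_def split: prod.splits)
  have wf: "wf_trm \<Sigma> (App g ts)"
    using oper(1) Q by (auto simp: ts_def wf_trm_map_trm Q_def)
  have ev: "map fst us = map (eval_trm M (case_sum A C)) ts" "map snd us = map (eval_trm M (case_sum A D)) ts"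
    "map fst vs = map (eval_trm M (case_sum B C)) ts" "map snd vs = map (eval_trm M (case_sum B D)) ts"
    using Q len by (auto simp: ts_def Q_def eval_trm_map_trm h intro!: nth_equalityI)
  show ?case
    using AB wf by (intro exI[of _ "App g ts"] exI[of _ A] exI[of _ B] exI[of _ C] exI[of _ D])
      (simp add: pair_oper_def ev)
qed

lemma centralizesI:
  fixes M :: "('f, 'a) algebra"
  assumes "\<And>p q r s. mat \<Sigma> M \<alpha> \<beta> (p, q) (r, s) \<Longrightarrow> (p, q) \<in> \<delta> \<Longrightarrow> (r, s) \<in> \<delta>"
  shows "centralizes \<Sigma> M \<alpha> \<beta> \<delta>"
  unfolding centralizes_def
proof (intro allI impI, elim conjE)
  fix t :: "('f, nat + nat) trm" and a b c d
  assume "wf_trm \<Sigma> t" "\<forall>i. (a i, b i) \<in> \<alpha>" "\<forall>j. (c j, d j) \<in> \<beta>"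
    "(eval_trm M (case_sum a c) t, eval_trm M (case_sum a d) t) \<in> \<delta>"
  then show "(eval_trm M (case_sum b c) t, eval_trm M (case_sum b d) t) \<in> \<delta>"
    using assms[OF mat_eval_trm[of \<Sigma> t a b \<alpha> c d \<beta> M]] by simp
qed

lemma centralizesD:
  fixes M :: "('f, 'a) algebra"
  assumes "centralizes \<Sigma> M \<alpha> \<beta> \<delta>" "mat \<Sigma> M \<alpha> \<beta> (p, q) (r, s)" "(p, q) \<in> \<delta>" "\<alpha> \<noteq> {}" "\<beta> \<noteq> {}"
  shows "(r, s) \<in> \<delta>"
proof -
  obtain t :: "('f, nat + nat) trm" and a b c d where
    "wf_trm \<Sigma> t" "\<forall>i. (a i, b i) \<in> \<alpha>" "\<forall>j. (c j, d j) \<in> \<beta>"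
    "(p, q) = (eval_trm M (case_sum a c) t, eval_trm M (case_sum a d) t)"
    "(r, s) = (eval_trm M (case_sum b c) t, eval_trm M (case_sum b d) t)"
    using mat_trm[OF assms(2,4,5)] by blast
  then show ?thesis
    using assms(1,3) unfolding centralizes_def by metis
qed

text \<open>The first tuple is exchanged in two moves, through an intermediate tuple. The form for
  arbitrary relations fits composites of congruences, which are not congruences in general.\<close>

lemma centralizes_relcomp:
  fixes M :: "('f, 'a) algebra"
  assumes "centralizes \<Sigma> M \<alpha> \<beta> \<delta>" "centralizes \<Sigma> M \<alpha>' \<beta> \<delta>" "\<gamma> \<subseteq> \<alpha> O \<alpha>'"
  shows "centralizes \<Sigma> M \<gamma> \<beta> \<delta>"
  unfolding centralizes_def
proof (intro allI impI, elim conjE)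
  fix t :: "('f, nat + nat) trm" and a b c d
  assume t: "wf_trm \<Sigma> t" and ab: "\<forall>i. (a i, b i) \<in> \<gamma>" and cd: "\<forall>j. (c j, d j) \<in> \<beta>"
    and *: "(eval_trm M (case_sum a c) t, eval_trm M (case_sum a d) t) \<in> \<delta>"
  have "\<forall>i. \<exists>e. (a i, e) \<in> \<alpha> \<and> (e, b i) \<in> \<alpha>'"
    using ab assms(3) by blast
  then obtain e where e: "\<forall>i. (a i, e i) \<in> \<alpha>" "\<forall>i. (e i, b i) \<in> \<alpha>'"
    by metis
  have "(eval_trm M (case_sum e c) t, eval_trm M (case_sum e d) t) \<in> \<delta>"
    using assms(1) t e(1) cd * unfolding centralizes_def by blast
  then show "(eval_trm M (case_sum b c) t, eval_trm M (case_sum b d) t) \<in> \<delta>"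
    using assms(2) t e(2) cd unfolding centralizes_def by blast
qed

lemma mat_rows_columns:
  assumes "mat \<Sigma> M \<alpha> \<beta> u v" "\<alpha> \<in> Con \<Sigma> M" "\<beta> \<in> Con \<Sigma> M"
  shows "u \<in> \<beta>" "v \<in> \<beta>" "(fst u, fst v) \<in> \<alpha>" "(snd u, snd v) \<in> \<alpha>"
proof -
  have "u \<in> \<beta> \<and> v \<in> \<beta> \<and> (fst u, fst v) \<in> \<alpha> \<and> (snd u, snd v) \<in> \<alpha>"
    using assms(1)
  proof (induction rule: mat.induct)
    case (oper g us vs)
    have *: "length us = length vs" "list_all2 (\<lambda>x y. (x, y) \<in> \<beta>) (map fst us) (map snd us)"
       "list_all2 (\<lambda>x y. (x, y) \<in> \<beta>) (map fst vs) (map snd vs)"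
       "list_all2 (\<lambda>x y. (x, y) \<in> \<alpha>) (map fst us) (map fst vs)"
       "list_all2 (\<lambda>x y. (x, y) \<in> \<alpha>) (map snd us) (map snd vs)"
      using oper(2) by (auto simp: list_all2_conv_all_nth)
    then show ?case
      using assms oper(1) by (auto simp: pair_oper_def intro!: Con_oper)
  qed (use assms(2,3) in \<open>auto intro: Con_refl dest: Con_carrierD\<close>)
  then show "u \<in> \<beta>" "v \<in> \<beta>" "(fst u, fst v) \<in> \<alpha>" "(snd u, snd v) \<in> \<alpha>"
    by auto
qed

text \<open>Exchanging the roles of the two tuples reflects the matrix, so symmetry of centrality
  becomes a comparison of rows with columns.\<close>

lemma mat_transpose:
  assumes "mat \<Sigma> M \<alpha> \<beta> u v"
  shows "mat \<Sigma> M \<beta> \<alpha> (fst u, fst v) (snd u, snd v)"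
  using assms
proof (induction rule: mat.induct)
  case (oper g us vs)
  let ?us = "zip (map fst us) (map fst vs)" and ?vs = "zip (map snd us) (map snd vs)"
  have len: "length us = length vs"
    using oper by (auto dest: list_all2_lengthD)
  have "list_all2 (mat \<Sigma> M \<beta> \<alpha>) ?us ?vs"
    using oper(2) by (auto simp: list_all2_conv_all_nth)
  then have "mat \<Sigma> M \<beta> \<alpha> (pair_oper M g ?us) (pair_oper M g ?vs)"
    using oper(1) len by (intro mat.oper) auto
  then show ?case
    using len by (simp add: pair_oper_def)
qed (auto intro: mat.intros)

lemma mat_sym:
  assumes "mat \<Sigma> M \<alpha> \<beta> u v" "sym \<alpha>"
  shows "mat \<Sigma> M \<alpha> \<beta> v u"
  using assms(1)
proof (induction rule: mat.induct)
  case (oper g us vs)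
  then show ?case
    by (intro mat.oper) (auto simp: list_all2_conv_all_nth)
qed (use assms(2) in \<open>auto intro: mat.intros dest: symD\<close>)

text \<open>The columns of a matrix lie in \<alpha>, so \<open>r\<close>, \<open>p\<close>,
  \<open>q\<close>, \<open>s\<close> is a chain in \<delta>.\<close>

lemma centralizes_below:
  assumes "\<alpha> \<in> Con \<Sigma> M" "\<beta> \<in> Con \<Sigma> M" "\<delta> \<in> Con \<Sigma> M" "\<alpha> \<subseteq> \<delta>"
  shows "centralizes \<Sigma> M \<alpha> \<beta> \<delta>"
proof (rule centralizesI)
  fix p q r s
  assume "mat \<Sigma> M \<alpha> \<beta> (p, q) (r, s)" "(p, q) \<in> \<delta>"
  then show "(r, s) \<in> \<delta>"
    using mat_rows_columns[of \<Sigma> M \<alpha> \<beta> "(p, q)" "(r, s)"] assms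
    by (auto intro: Con_trans Con_sym)
qed

text \<open>The columns link \<open>r\<close>, \<open>p\<close>, \<open>q\<close>, \<open>s\<close>
  inside \<alpha>, and the row \<open>(r, s)\<close> lies in \<beta> by itself. This is the source
  of the bound of the commutator by the meet.\<close>

lemma centralizes_Int:
  assumes "\<alpha> \<in> Con \<Sigma> M" "\<beta> \<in> Con \<Sigma> M"
  shows "centralizes \<Sigma> M \<alpha> \<beta> (\<alpha> \<inter> \<beta>)"
proof (rule centralizesI)
  fix p q r s
  assume "mat \<Sigma> M \<alpha> \<beta> (p, q) (r, s)" "(p, q) \<in> \<alpha> \<inter> \<beta>"
  then show "(r, s) \<in> \<alpha> \<inter> \<beta>"
    using mat_rows_columns[of \<Sigma> M \<alpha> \<beta> "(p, q)" "(r, s)"] assms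
    by (auto intro: Con_trans Con_sym)
qed

text \<open>Evaluation of terms commutes with \<open>h\<close>, so an instance of the term condition
  in \<open>P\<close> maps to one in \<open>Q\<close>.\<close>

lemma centralizes_pullback:
  fixes P :: "('f, 'a) algebra"
  assumes P: "is_algebra \<Sigma> P" and h: "morphism \<Sigma> P Q h"
    and C: "centralizes \<Sigma> Q \<alpha> \<beta> \<delta>"
  shows "centralizes \<Sigma> P (pullback P h \<alpha>) (pullback P h \<beta>) (pullback P h \<delta>)"
  unfolding centralizes_def
proof (intro allI impI, elim conjE)
  fix t :: "('f, nat + nat) trm" and a b c d
  assume t: "wf_trm \<Sigma> t" and ab: "\<forall>i. (a i, b i) \<in> pullback P h \<alpha>"
    and cd: "\<forall>j. (c j, d j) \<in> pullback P h \<beta>"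
    and *: "(eval_trm P (case_sum a c) t, eval_trm P (case_sum a d) t) \<in> pullback P h \<delta>"
  have rg: "range (case_sum x y) \<subseteq> carrier P"
    if "x \<in> {a, b}" "y \<in> {c, d}" for x y
    using that ab cd by (auto simp: pullback_iff split: sum.splits)
  have ev: "h (eval_trm P (case_sum x y) t) = eval_trm Q (case_sum (h \<circ> x) (h \<circ> y)) t"
    if "x \<in> {a, b}" "y \<in> {c, d}" for x y
    using eval_trm_morphism[OF P h rg[OF that] t] by (simp add: case_sum_o_inj o_case_sum)
  have "(eval_trm Q (case_sum (h \<circ> b) (h \<circ> c)) t, eval_trm Q (case_sum (h \<circ> b) (h \<circ> d)) t) \<in> \<delta>"
  proof -
    have "\<forall>i. ((h \<circ> a) i, (h \<circ> b) i) \<in> \<alpha>" "\<forall>j. ((h \<circ> c) j, (h \<circ> d) j) \<in> \<beta>"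
      using ab cd by (auto simp: pullback_iff)
    moreover have "(eval_trm Q (case_sum (h \<circ> a) (h \<circ> c)) t, eval_trm Q (case_sum (h \<circ> a) (h \<circ> d)) t) \<in> \<delta>"
      using * by (simp add: pullback_iff ev)
    ultimately show ?thesis
      using C t unfolding centralizes_def by blast
  qed
  then show "(eval_trm P (case_sum b c) t, eval_trm P (case_sum b d) t) \<in> pullback P h \<delta>"
    using eval_trm_carrier[OF P rg t] by (simp add: pullback_iff ev)
qed

section \<open>The commutator as a least centralizing congruence\<close>

lemma commutator_le:
  "\<delta> \<in> Con \<Sigma> M \<Longrightarrow> centralizes \<Sigma> M \<alpha> \<beta> \<delta> \<Longrightarrow> commutator \<Sigma> M \<alpha> \<beta> \<subseteq> \<delta>"
  by (auto simp: commutator_def)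

text \<open>Ensures that the family intersected in \<open>commutator\<close> is non-empty.\<close>

lemma centralizes_nabla:
  assumes "is_algebra \<Sigma> M" "\<alpha> \<in> Con \<Sigma> M" "\<beta> \<in> Con \<Sigma> M"
  shows "centralizes \<Sigma> M \<alpha> \<beta> (nabla M)"
  using assms by (intro centralizes_below Con_nabla) (auto simp: nabla_def dest: Con_carrier)

lemma commutator_Con:
  assumes "is_algebra \<Sigma> M" "\<alpha> \<in> Con \<Sigma> M" "\<beta> \<in> Con \<Sigma> M"
  shows "commutator \<Sigma> M \<alpha> \<beta> \<in> Con \<Sigma> M"
  unfolding commutator_def
  by (rule Con_Inter) (use assms centralizes_nabla Con_nabla in blast)+

lemma centralizes_commutator: "centralizes \<Sigma> M \<alpha> \<beta> (commutator \<Sigma> M \<alpha> \<beta>)"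
  unfolding centralizes_def commutator_def by blast

section \<open>A congruence as an algebra, and the congruence on it spanned by matrices\<close>

lemma pair_algebra_is_algebra:
  assumes "is_algebra \<Sigma> M" "\<theta> \<in> Con \<Sigma> M"
  shows "is_algebra \<Sigma> (pair_algebra M \<theta>)"
  unfolding is_algebra_def
proof (intro conjI allI impI)
  show "carrier (pair_algebra M \<theta>) \<noteq> {}"
    using assms by (auto simp: is_algebra_def intro: Con_refl)
  fix g as
  assume *: "\<Sigma> g = Some (length as) \<and> set as \<subseteq> carrier (pair_algebra M \<theta>)"
  then have "list_all2 (\<lambda>x y. (x, y) \<in> \<theta>) (map fst as) (map snd as)"
    by (auto simp: list_all2_conv_all_nth dest: nth_mem)
  then show "oper (pair_algebra M \<theta>) g as \<in> carrier (pair_algebra M \<theta>)"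
    using * assms by (auto simp: pair_oper_def intro!: Con_oper)
qed

lemma morphism_fst: "\<theta> \<in> Con \<Sigma> M \<Longrightarrow> morphism \<Sigma> (pair_algebra M \<theta>) M fst"
  by (use Con_carrier in \<open>fastforce simp: morphism_def pair_oper_def\<close>)

lemma morphism_snd: "\<theta> \<in> Con \<Sigma> M \<Longrightarrow> morphism \<Sigma> (pair_algebra M \<theta>) M snd"
  by (use Con_carrier in \<open>fastforce simp: morphism_def pair_oper_def\<close>)

text \<open>Matrices cannot be composed in general, so that passing to the transitive closure is needed
  to obtain a congruence.\<close>

definition mat_con :: "'f signature \<Rightarrow> ('f, 'a) algebra \<Rightarrow> 'a rel \<Rightarrow> 'a rel \<Rightarrow> ('a \<times> 'a) rel" where
  "mat_con \<Sigma> M \<alpha> \<beta> = {(u, v). mat \<Sigma> M \<alpha> \<beta> u v}\<^sup>+"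

text \<open>Matrices are reflexive on \<beta> by \<open>right\<close>, symmetric by exchange of rows
  and compatible with operations by \<open>oper\<close>. What remains is to reconcile the transitive
  closure with the operations.\<close>

lemma mat_con_Con:
  assumes "is_algebra \<Sigma> M" "\<alpha> \<in> Con \<Sigma> M" "\<beta> \<in> Con \<Sigma> M"
  shows "mat_con \<Sigma> M \<alpha> \<beta> \<in> Con \<Sigma> (pair_algebra M \<beta>)"
proof (rule ConI)
  let ?R = "{(u, v). mat \<Sigma> M \<alpha> \<beta> u v}"
  have R: "?R \<subseteq> \<beta> \<times> \<beta>"
    using mat_rows_columns[OF _ assms(2,3)] by auto
  show sub: "mat_con \<Sigma> M \<alpha> \<beta> \<subseteq> carrier (pair_algebra M \<beta>) \<times> carrier (pair_algebra M \<beta>)"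
    using R unfolding mat_con_def by (simp add: trancl_subset_Sigma)
  have refl: "(u, u) \<in> ?R" if "u \<in> \<beta>" for u
    using that by (cases u) (auto intro: mat.right)
  then show "(u, u) \<in> mat_con \<Sigma> M \<alpha> \<beta>" if "u \<in> carrier (pair_algebra M \<beta>)" for u
    using that unfolding mat_con_def by (intro r_into_trancl) simp
  have "sym ?R"
    using mat_sym[of \<Sigma> M \<alpha> \<beta>] assms(2) by (auto simp: sym_def Con_def equiv_def)
  then show "(v, u) \<in> mat_con \<Sigma> M \<alpha> \<beta>" if "(u, v) \<in> mat_con \<Sigma> M \<alpha> \<beta>" for u v
    using that sym_trancl[of ?R] unfolding mat_con_def by (auto dest: symD)
  show "(u, w) \<in> mat_con \<Sigma> M \<alpha> \<beta>" if "(u, v) \<in> mat_con \<Sigma> M \<alpha> \<beta>" "(v, w) \<in> mat_con \<Sigma> M \<alpha> \<beta>" for u v w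
    using that unfolding mat_con_def by (rule trancl_trans)
  fix g us vs
  assume g: "\<Sigma> g = Some (length us)" and l: "list_all2 (\<lambda>x y. (x, y) \<in> mat_con \<Sigma> M \<alpha> \<beta>) us vs"
  have us: "set us \<subseteq> \<beta>"
    using list_all2_subset_carrier[OF l sub] by simp
  \<comment> \<open>The arguments are changed one at a time: a list of chains becomes a chain of
    lists, in which each step alters a single entry.\<close>
  have "(us, vs) \<in> listrel (?R\<^sup>*)"
    using l unfolding mat_con_def by (auto simp: listrel_iff_nth list_all2_conv_all_nth)
  then have "(us, vs) \<in> (listrel1 ?R)\<^sup>*"
    by (simp add: listrel_rtrancl_eq_rtrancl_listrel1)
  then have "set vs \<subseteq> \<beta> \<and> length vs = length us \<and> (pair_oper M g us, pair_oper M g vs) \<in> ?R\<^sup>+"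
  proof (induction rule: rtrancl_induct)
    case base
    have "list_all2 (mat \<Sigma> M \<alpha> \<beta>) us us"
      using us refl by (intro list.rel_refl_strong) auto
    then show ?case
      using us g by (auto intro!: mat.oper)
  next
    case (step ws vs)
    then obtain xs y z ys where e: "ws = xs @ y # ys" "vs = xs @ z # ys" "(y, z) \<in> ?R"
      by (auto elim!: listrel1E)
    have sv: "set vs \<subseteq> \<beta>"
      using e step.IH R by auto
    have "list_all2 (mat \<Sigma> M \<alpha> \<beta>) ws vs"
      unfolding e(1,2) using e sv refl
      by (intro list_all2_appendI) (auto simp: list_all2_same)
    then have "(pair_oper M g ws, pair_oper M g vs) \<in> ?R"
      using step.IH g by (auto intro!: mat.oper)
    then show ?case
      using step.IH sv e by (auto intro: trancl_into_trancl)
  qed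
  then show "(oper (pair_algebra M \<beta>) g us, oper (pair_algebra M \<beta>) g vs) \<in> mat_con \<Sigma> M \<alpha> \<beta>"
    by (simp add: mat_con_def)
qed

text \<open>Centrality carries membership in \<delta> from the first row of a matrix to the second,
  hence along chains of matrices.\<close>

lemma mat_con_centralizes:
  assumes "centralizes \<Sigma> M \<alpha> \<beta> \<delta>" "(u, v) \<in> mat_con \<Sigma> M \<alpha> \<beta>" "u \<in> \<delta>" "\<alpha> \<noteq> {}" "\<beta> \<noteq> {}"
  shows "v \<in> \<delta>"
  using assms(2) unfolding mat_con_def
proof (induction rule: trancl_induct)
  case (base v)
  then show ?case
    using centralizesD[OF assms(1), of "fst u" "snd u" "fst v" "snd v"] assms by simp
next
  case (step v w)
  then show ?case
    using centralizesD[OF assms(1), of "fst v" "snd v" "fst w" "snd w"] assms by simp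
qed

lemma mat_con_left: "(x, y) \<in> \<alpha> \<Longrightarrow> ((x, x), (y, y)) \<in> mat_con \<Sigma> M \<alpha> \<beta>"
  unfolding mat_con_def by (auto intro: mat.left)


section \<open>Perfect congruence-modular classes\<close>

definition image_algebra :: "('a \<Rightarrow> 'b) \<Rightarrow> ('f, 'a) algebra \<Rightarrow> ('f, 'b) algebra" where
  "image_algebra e M = \<lparr>carrier = e ` carrier M,
     oper = (\<lambda>g xs. e (oper M g (map (inv_into (carrier M) e) xs)))\<rparr>"

lemma image_algebra_simps [simp]:
  "carrier (image_algebra e M) = e ` carrier M"
  "oper (image_algebra e M) g xs = e (oper M g (map (inv_into (carrier M) e) xs))"
  by (simp_all add: image_algebra_def)

text \<open>The homomorphism points from the copy to \<open>M\<close>, so that congruences of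
  \<open>M\<close> and the term condition can be pulled back to the copy.\<close>

lemma image_algebra_morphism:
  assumes "is_algebra \<Sigma> M" "inj_on e (carrier M)"
  shows "morphism \<Sigma> (image_algebra e M) M (inv_into (carrier M) e)"
  unfolding morphism_def
proof (intro conjI allI impI)
  fix g xs
  assume *: "\<Sigma> g = Some (length xs) \<and> set xs \<subseteq> carrier (image_algebra e M)"
  then have "oper M g (map (inv_into (carrier M) e) xs) \<in> carrier M"
    using assms by (intro is_algebra_oper[where \<Sigma> = \<Sigma>]) (auto intro: inv_into_into)
  then show "inv_into (carrier M) e (oper (image_algebra e M) g xs)
    = oper M g (map (inv_into (carrier M) e) xs)"
    using assms(2) by simp
qed (auto intro: inv_into_into)

lemma image_algebra_is_algebra:
  assumes "is_algebra \<Sigma> M"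
  shows "is_algebra \<Sigma> (image_algebra e M)"
  unfolding is_algebra_def
proof (intro conjI allI impI)
  show "carrier (image_algebra e M) \<noteq> {}"
    using assms by (auto simp: is_algebra_def)
  fix g xs
  assume "\<Sigma> g = Some (length xs) \<and> set xs \<subseteq> carrier (image_algebra e M)"
  then have "oper M g (map (inv_into (carrier M) e) xs) \<in> carrier M"
    using assms by (intro is_algebra_oper[where \<Sigma> = \<Sigma>]) (auto intro: inv_into_into)
  then show "oper (image_algebra e M) g xs \<in> carrier (image_algebra e M)"
    by simp
qed

text \<open>The hypotheses are available only for carriers in the type \<open>'u\<close>; other algebras of the class
  are accessed through injections of their carriers into \<open>'u\<close>, which \<open>pair\<close> makes
  possible for squares as well.\<close>

locale perfect_modular_class =
  fixes \<Sigma> :: "'f signature" and E :: "'f equations" and pair :: "'u \<Rightarrow> 'u \<Rightarrow> 'u"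
  assumes wf_eqs: "wf_equations \<Sigma> E"
    and pair_inject: "\<And>a b c d. pair a b = pair c d \<Longrightarrow> a = c \<and> b = d"
    and modular: "\<And>M :: ('f, 'u) algebra. M \<in> equational_class \<Sigma> E \<Longrightarrow> Con_modular \<Sigma> M"
    and perfect: "\<And>M :: ('f, 'u) algebra. M \<in> equational_class \<Sigma> E
      \<Longrightarrow> commutator \<Sigma> M (nabla M) (nabla M) = nabla M"
begin

lemma image_algebra_class:
  assumes "M \<in> equational_class \<Sigma> E" "inj_on e (carrier M)"
  shows "image_algebra e M \<in> equational_class \<Sigma> E"
proof (rule equational_class_jointly_injective[OF wf_eqs, where I = UNIV and
      Q = "\<lambda>_ :: unit. M" and h = "\<lambda>_. inv_into (carrier M) e"])
  show "is_algebra \<Sigma> (image_algebra e M)"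
    using assms by (intro image_algebra_is_algebra equational_class_is_algebra)
  show "morphism \<Sigma> (image_algebra e M) M (inv_into (carrier M) e)"
    using assms by (intro image_algebra_morphism) (auto intro: equational_class_is_algebra)
qed (use assms in \<open>auto dest: inv_into_injective\<close>)

lemma pair_algebra_class:
  assumes "M \<in> equational_class \<Sigma> E" "\<theta> \<in> Con \<Sigma> M"
  shows "pair_algebra M \<theta> \<in> equational_class \<Sigma> E"
proof (rule equational_class_jointly_injective[OF wf_eqs, where I = UNIV and
      Q = "\<lambda>_. M" and h = "\<lambda>b. if b then fst else snd"])
  show "is_algebra \<Sigma> (pair_algebra M \<theta>)"
    using assms by (intro pair_algebra_is_algebra) (auto intro: equational_class_is_algebra)
  show "x = y" if "\<And>b. b \<in> UNIV \<Longrightarrow> (if b then fst else snd) x = (if b then fst else snd) y"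
    for x y :: "'a \<times> 'a"
    using that[of True] that[of False] by (simp add: prod_eq_iff)
qed (use assms in \<open>auto intro: morphism_fst morphism_snd\<close>)

text \<open>Iterated, this also embeds pairs of pairs, which arise when the shifting lemma is
  applied inside an algebra of pairs.\<close>

lemma pair_algebra_inj:
  assumes "inj_on (e :: 'c \<Rightarrow> 'u) (carrier M)" "\<theta> \<in> Con \<Sigma> M"
  shows "inj_on (\<lambda>(a, b). pair (e a) (e b)) (carrier (pair_algebra M \<theta>))"
proof (rule inj_onI)
  fix u v
  assume *: "u \<in> carrier (pair_algebra M \<theta>)" "v \<in> carrier (pair_algebra M \<theta>)"
    "(case u of (a, b) \<Rightarrow> pair (e a) (e b)) = (case v of (a, b) \<Rightarrow> pair (e a) (e b))"
  then have "e (fst u) = e (fst v)" "e (snd u) = e (snd v)"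
    by (auto simp: case_prod_beta dest: pair_inject)
  moreover have "fst w \<in> carrier M" "snd w \<in> carrier M" if "w \<in> \<theta>" for w
    using that Con_carrierD[OF assms(2), of "fst w" "snd w"] by simp_all
  ultimately show "u = v"
    using *(1,2) inj_onD[OF assms(1)] by (simp add: prod_eq_iff)
qed

text \<open>Since the meet of \<beta> and \<gamma> is below \<alpha>, modularity says that the join
  of \<alpha> and \<beta> meets \<gamma> in \<alpha> only; the chain \<open>x\<close>,
  \<open>x'\<close>, \<open>y'\<close>, \<open>y\<close> puts \<open>(x, y)\<close> into that join.
  The law is applied in the copy of \<open>M\<close> over \<open>'u\<close>.\<close>

lemma modular_law:
  assumes M: "M \<in> equational_class \<Sigma> E" and e: "inj_on (e :: 'c \<Rightarrow> 'u) (carrier M)"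
    and con: "\<alpha> \<in> Con \<Sigma> M" "\<beta> \<in> Con \<Sigma> M" "\<gamma> \<in> Con \<Sigma> M" and le: "\<alpha> \<subseteq> \<gamma>" "\<beta> \<inter> \<gamma> \<subseteq> \<alpha>"
    and pts: "(x, x') \<in> \<beta>" "(x', y') \<in> \<alpha>" "(y', y) \<in> \<beta>" "(x, y) \<in> \<gamma>"
  shows "(x, y) \<in> \<alpha>"
proof -
  define P where "P = image_algebra e M"
  define h where "h = inv_into (carrier M) e"
  have PE: "P \<in> equational_class \<Sigma> E"
    unfolding P_def using M e by (rule image_algebra_class)
  have P: "is_algebra \<Sigma> P" and h: "morphism \<Sigma> P M h"
    using PE image_algebra_morphism[OF equational_class_is_algebra[OF M] e]
    by (auto simp: P_def h_def intro: equational_class_is_algebra)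
  have con': "pullback P h \<alpha> \<in> Con \<Sigma> P" "pullback P h \<beta> \<in> Con \<Sigma> P" "pullback P h \<gamma> \<in> Con \<Sigma> P"
    using con by (auto intro: Con_pullback[OF P h])
  have pull: "(e a, e b) \<in> pullback P h \<psi> \<longleftrightarrow> (a, b) \<in> \<psi>" if "\<psi> \<in> Con \<Sigma> M" "a \<in> carrier M" "b \<in> carrier M" for \<psi> a b
    using that e by (simp add: pullback_iff P_def h_def)
  have cr: "x \<in> carrier M" "x' \<in> carrier M" "y' \<in> carrier M" "y \<in> carrier M"
    using Con_carrierD[OF con(2) pts(1)] Con_carrierD[OF con(2) pts(3)] by auto
  have "(e x, e y) \<in> \<theta>" if "\<theta> \<in> Con \<Sigma> P" "pullback P h \<alpha> \<union> pullback P h \<beta> \<subseteq> \<theta>" for \<theta>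
  proof -
    have "(e x, e x') \<in> \<theta>" "(e x', e y') \<in> \<theta>" "(e y', e y) \<in> \<theta>"
      using that(2) pull con cr pts by auto
    then show ?thesis
      using Con_trans[OF that(1)] by blast
  qed
  then have "(e x, e y) \<in> con_join \<Sigma> P (pullback P h \<alpha>) (pullback P h \<beta>) \<inter> pullback P h \<gamma>"
    using pull[OF con(3)] cr pts by (auto simp: con_join_def)
  moreover have "pullback P h \<alpha> \<subseteq> pullback P h \<gamma>"
    using le(1) by (auto simp: pullback_iff)
  ultimately have "(e x, e y) \<in> con_join \<Sigma> P (pullback P h \<alpha>) (pullback P h \<beta> \<inter> pullback P h \<gamma>)"
    using modular[OF PE] con' unfolding Con_modular_def by blast
  \<comment> \<open>Hence the copy of \<alpha> is an upper bound of both joinands, and the join lies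
    below it.\<close>
  moreover have "pullback P h \<beta> \<inter> pullback P h \<gamma> \<subseteq> pullback P h \<alpha>"
    using le(2) by (auto simp: pullback_iff)
  ultimately have "(e x, e y) \<in> pullback P h \<alpha>"
    using con' by (auto simp: con_join_def)
  then show ?thesis
    using pull[OF con(1)] cr by simp
qed

text \<open>In the copy of \<open>M\<close> the commutator of the full relation with itself is below
  the preimage of \<delta>, and perfectness makes it the full relation.\<close>

lemma perfect_nabla:
  assumes M: "M \<in> equational_class \<Sigma> E" and e: "inj_on (e :: 'c \<Rightarrow> 'u) (carrier M)"
    and \<delta>: "\<delta> \<in> Con \<Sigma> M" "centralizes \<Sigma> M (nabla M) (nabla M) \<delta>"
    and xy: "x \<in> carrier M" "y \<in> carrier M"
  shows "(x, y) \<in> \<delta>"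
proof -
  define P where "P = image_algebra e M"
  define h where "h = inv_into (carrier M) e"
  have PE: "P \<in> equational_class \<Sigma> E"
    unfolding P_def using M e by (rule image_algebra_class)
  have P: "is_algebra \<Sigma> P" and h: "morphism \<Sigma> P M h"
    using PE image_algebra_morphism[OF equational_class_is_algebra[OF M] e]
    by (auto simp: P_def h_def intro: equational_class_is_algebra)
  have "nabla P = pullback P h (nabla M)"
    using morphism_carrier[OF h] by (auto simp: nabla_def pullback_def)
  then have "centralizes \<Sigma> P (nabla P) (nabla P) (pullback P h \<delta>)"
    using centralizes_pullback[OF P h \<delta>(2)] by simp
  then have "nabla P \<subseteq> pullback P h \<delta>"
    using commutator_le[OF Con_pullback[OF P h \<delta>(1)]] perfect[OF PE] by auto
  moreover have "(e x, e y) \<in> nabla P"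
    using xy by (simp add: nabla_def P_def)
  ultimately show ?thesis
    using xy e by (auto simp: pullback_iff h_def)
qed

text \<open>Gumm's shifting lemma: modularity of the congruences of \<open>\<beta>\<close>, as a subalgebra of the square,
  moves the pair \<open>(x, y)\<close> along \<open>\<beta>\<close> through the diagonal elements \<open>(u, u)\<close> and \<open>(v, v)\<close>.\<close>

lemma shifting:
  assumes M: "M \<in> equational_class \<Sigma> E" and e: "inj_on (e :: 'c \<Rightarrow> 'u) (carrier M)"
    and con: "\<alpha> \<in> Con \<Sigma> M" "\<beta> \<in> Con \<Sigma> M" "\<gamma> \<in> Con \<Sigma> M" and le: "\<alpha> \<inter> \<beta> \<subseteq> \<gamma>"
    and pts: "(x, y) \<in> \<alpha>" "(u, v) \<in> \<alpha>" "(x, u) \<in> \<beta>" "(y, v) \<in> \<beta>" "(x, y) \<in> \<gamma>"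
  shows "(u, v) \<in> \<gamma>"
proof -
  let ?B = "pair_algebra M \<beta>"
  have B: "?B \<in> equational_class \<Sigma> E" "inj_on (\<lambda>(a, b). pair (e a) (e b)) (carrier ?B)"
    using pair_algebra_class[OF M con(2)] pair_algebra_inj[OF e con(2)] by blast+
  have al: "is_algebra \<Sigma> M" "is_algebra \<Sigma> ?B"
    using M B by (auto intro: equational_class_is_algebra)
  note fst = Con_pullback[OF al(2) morphism_fst[OF con(2)]]
    and snd = Con_pullback[OF al(2) morphism_snd[OF con(2)]]
  let ?\<alpha> = "pullback ?B fst \<alpha> \<inter> pullback ?B snd \<alpha>"
  let ?\<gamma> = "pullback ?B fst \<gamma> \<inter> ?\<alpha>"
  let ?\<eta> = "pullback ?B snd (Id_on (carrier M))"
  have cr: "u \<in> carrier M" "v \<in> carrier M"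
    using Con_carrierD[OF con(1) pts(2)] by auto
  note refl = Con_refl[OF con(1)] Con_refl[OF con(2)]
  \<comment> \<open>The chain is \<open>(u, u)\<close>, \<open>(x, u)\<close>,
    \<open>(y, v)\<close>, \<open>(v, v)\<close>: its outer links keep the second component, and its
    middle link lies in \<open>?\<gamma>\<close> because \<open>(x, y)\<close> is in
    \<gamma>.\<close>
  have "((u, u), (v, v)) \<in> ?\<gamma>"
  proof (rule modular_law[OF B, where \<beta> = ?\<eta> and \<gamma> = ?\<alpha> and x' = "(x, u)" and y' = "(y, v)"])
    show "?\<gamma> \<in> Con \<Sigma> ?B" "?\<alpha> \<in> Con \<Sigma> ?B" "?\<eta> \<in> Con \<Sigma> ?B"
      using con al by (auto intro!: Con_Int fst snd Con_Id_on)
    show "?\<eta> \<inter> ?\<alpha> \<subseteq> ?\<gamma>"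
    proof
      fix w assume "w \<in> ?\<eta> \<inter> ?\<alpha>"
      then obtain a b c where w: "w = ((a, c), (b, c))" "(a, c) \<in> \<beta>" "(b, c) \<in> \<beta>" "(a, b) \<in> \<alpha>" "w \<in> ?\<alpha>"
        by (auto simp: pullback_def)
      \<comment> \<open>Through the common second component \<open>c\<close>; thus
        \<open>(a, b)\<close> falls under the hypothesis on the meet of \<alpha> and
        \<beta>.\<close>
      then have "(a, b) \<in> \<beta>"
        using Con_trans[OF con(2)] Con_sym[OF con(2)] by blast
      then show "w \<in> ?\<gamma>"
        using w le by (auto simp: pullback_def)
    qed
  qed (use pts cr refl in \<open>auto simp: pullback_iff\<close>)
  then show ?thesis
    by (simp add: pullback_iff)
qed

text \<open>After transposition the claim passes from one column to the other, whereas
  \<open>C\<close> passes between rows. Two shifts in the algebra \<beta> bridge this: the first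
  turns \<open>C\<close> into \<open>?\<Delta> \<inter> ?\<eta>0 \<subseteq> ?\<delta>1\<close>,
  which is the side condition of the second.\<close>

lemma centralizes_commute:
  assumes M: "M \<in> equational_class \<Sigma> E" and e: "inj_on (e :: 'c \<Rightarrow> 'u) (carrier M)"
    and con: "\<alpha> \<in> Con \<Sigma> M" "\<beta> \<in> Con \<Sigma> M" "\<delta> \<in> Con \<Sigma> M" and C: "centralizes \<Sigma> M \<alpha> \<beta> \<delta>"
  shows "centralizes \<Sigma> M \<beta> \<alpha> \<delta>"
proof (rule centralizesI)
  fix p r q s
  assume mat: "mat \<Sigma> M \<beta> \<alpha> (p, r) (q, s)" and pr: "(p, r) \<in> \<delta>"
  let ?B = "pair_algebra M \<beta>"
  have B: "?B \<in> equational_class \<Sigma> E" "inj_on (\<lambda>(a, b). pair (e a) (e b)) (carrier ?B)"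
    using pair_algebra_class[OF M con(2)] pair_algebra_inj[OF e con(2)] by blast+
  have al: "is_algebra \<Sigma> M" "is_algebra \<Sigma> ?B"
    using M B by (auto intro: equational_class_is_algebra)
  have ne: "\<alpha> \<noteq> {}" "\<beta> \<noteq> {}"
    using al(1) con(1,2) by (auto simp: is_algebra_def dest: Con_refl)
  note fst = Con_pullback[OF al(2) morphism_fst[OF con(2)]]
    and snd = Con_pullback[OF al(2) morphism_snd[OF con(2)]]
  let ?\<Delta> = "mat_con \<Sigma> M \<alpha> \<beta>"
  let ?\<eta>0 = "pullback ?B fst (Id_on (carrier M))" and ?\<eta>1 = "pullback ?B snd (Id_on (carrier M))"
  let ?\<delta>1 = "pullback ?B snd \<delta>"
  have \<Delta>: "?\<Delta> \<in> Con \<Sigma> ?B"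
    using al(1) con(1,2) by (rule mat_con_Con)
  have \<eta>: "?\<eta>0 \<in> Con \<Sigma> ?B" "?\<eta>1 \<in> Con \<Sigma> ?B" "?\<delta>1 \<in> Con \<Sigma> ?B"
    using al con by (auto intro!: fst snd Con_Id_on)
  have \<eta>\<Delta>: "?\<Delta> \<inter> ?\<eta>0 \<subseteq> ?\<delta>1"
  proof
    fix w assume "w \<in> ?\<Delta> \<inter> ?\<eta>0"
    then obtain x y z where w: "w = ((x, y), (x, z))" "(x, y) \<in> \<beta>" "(x, z) \<in> \<beta>" "w \<in> ?\<Delta>"
      by (auto simp: pullback_def)
    have yz: "(y, z) \<in> \<beta>"
      using w(2,3) Con_trans[OF con(2)] Con_sym[OF con(2)] by blast
    have cr: "x \<in> carrier M" "y \<in> carrier M" "z \<in> carrier M"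
      using w(2,3) Con_carrierD[OF con(2)] by blast+
    \<comment> \<open>Shifting along \<open>?\<eta>1\<close> replaces the common first component
      \<open>x\<close> by \<open>y\<close>, so that the chain of matrices starts on the diagonal,
      inside \<delta>.\<close>
    have "((y, y), (y, z)) \<in> ?\<Delta>"
    proof (rule shifting[OF B \<eta>(1,2) \<Delta>])
      show "?\<eta>0 \<inter> ?\<eta>1 \<subseteq> ?\<Delta>"
        using Con_refl[OF \<Delta>] by (auto simp: pullback_def)
      show "((x, y), (x, z)) \<in> ?\<Delta>"
        using w by simp
    qed (use cr w(2,3) yz Con_refl[OF con(2)] in \<open>auto simp: pullback_iff\<close>)
    then have "(y, z) \<in> \<delta>"
      using mat_con_centralizes[OF C _ _ ne] cr Con_refl[OF con(3)] by blast
    then show "w \<in> ?\<delta>1"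
      using w by (simp add: pullback_iff)
  qed
  have mat': "mat \<Sigma> M \<alpha> \<beta> (p, q) (r, s)"
    using mat_transpose[OF mat] by simp
  note rc = mat_rows_columns[OF mat' con(1,2), simplified]
  have cr: "p \<in> carrier M" "r \<in> carrier M"
    using Con_carrierD[OF con(1) rc(3)] by blast+
  \<comment> \<open>The diagonal pair \<open>((p, p), (r, r))\<close> is in
    \<open>?\<delta>1\<close> as \<open>(p, r)\<close> is in \<delta>; shifting along
    \<open>?\<eta>0\<close> replaces its second components by \<open>q\<close> and
    \<open>s\<close>.\<close>
  have "((p, q), (r, s)) \<in> ?\<delta>1"
  proof (rule shifting[OF B \<Delta> \<eta>(1,3) \<eta>\<Delta>])
    show "((p, p), (r, r)) \<in> ?\<Delta>"
      using rc by (intro mat_con_left)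
    show "((p, q), (r, s)) \<in> ?\<Delta>"
      using mat' by (auto simp: mat_con_def)
  qed (use cr rc pr Con_refl[OF con(2)] in \<open>auto simp: pullback_iff\<close>)
  then show "(q, s) \<in> \<delta>"
    by (simp add: pullback_iff)
qed

text \<open>If \<open>\<theta>\<close> is central modulo \<open>\<delta>\<close>, then \<open>\<theta>\<close>, as an algebra, has an abelian quotient in which the
  diagonal is a single element. By perfectness this quotient is trivial.\<close>

lemma perfect_central:
  assumes M: "M \<in> equational_class \<Sigma> E" and e: "inj_on (e :: 'c \<Rightarrow> 'u) (carrier M)"
    and con: "\<theta> \<in> Con \<Sigma> M" "\<delta> \<in> Con \<Sigma> M" and C: "centralizes \<Sigma> M (nabla M) \<theta> \<delta>"
  shows "\<theta> \<subseteq> \<delta>"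
proof -
  let ?B = "pair_algebra M \<theta>"
  have B: "?B \<in> equational_class \<Sigma> E" "inj_on (\<lambda>(a, b). pair (e a) (e b)) (carrier ?B)"
    using pair_algebra_class[OF M con(1)] pair_algebra_inj[OF e con(1)] by blast+
  have al: "is_algebra \<Sigma> M" "is_algebra \<Sigma> ?B"
    using M B by (auto intro: equational_class_is_algebra)
  have ne: "nabla M \<noteq> {}" "\<theta> \<noteq> {}"
    using al(1) con(1) by (auto simp: is_algebra_def nabla_def dest: Con_refl)
  note cr = Con_carrierD[OF con(1)] and refl = Con_refl[OF con(1)]
  note fst = Con_pullback[OF al(2) morphism_fst[OF con(1)]]
    and snd = Con_pullback[OF al(2) morphism_snd[OF con(1)]]
  let ?\<Delta> = "mat_con \<Sigma> M (nabla M) \<theta>"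
  let ?\<eta>0 = "pullback ?B fst (Id_on (carrier M))" and ?\<eta>1 = "pullback ?B snd (Id_on (carrier M))"
  have \<Delta>: "?\<Delta> \<in> Con \<Sigma> ?B"
    using al(1) con(1) by (intro mat_con_Con Con_nabla)
  have \<eta>: "?\<eta>0 \<in> Con \<Sigma> ?B" "?\<eta>1 \<in> Con \<Sigma> ?B" and \<nabla>: "nabla ?B \<in> Con \<Sigma> ?B"
    using al by (auto intro!: fst snd Con_Id_on Con_nabla)
  have diag: "((x, x), (y, y)) \<in> ?\<Delta>" if "x \<in> carrier M" "y \<in> carrier M" for x y
    using that by (intro mat_con_left) (simp add: nabla_def)
  \<comment> \<open>Any two pairs are linked through the diagonal with second components kept at the
    ends: \<open>(x, y)\<close>, \<open>(y, y)\<close>, \<open>(v, v)\<close>,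
    \<open>(u, v)\<close>.\<close>
  have "nabla ?B \<subseteq> (?\<eta>1 O ?\<Delta>) O ?\<eta>1"
  proof
    fix w assume "w \<in> nabla ?B"
    then obtain x y u v where w: "w = ((x, y), (u, v))" "(x, y) \<in> \<theta>" "(u, v) \<in> \<theta>"
      by (auto simp: nabla_def)
    then have "((x, y), (y, y)) \<in> ?\<eta>1" "((v, v), (u, v)) \<in> ?\<eta>1" "((y, y), (v, v)) \<in> ?\<Delta>"
      using cr refl by (auto simp: pullback_iff intro!: diag)
    then show "w \<in> (?\<eta>1 O ?\<Delta>) O ?\<eta>1"
      unfolding w(1) by blast
  qed
  \<comment> \<open>The kernels of the two projections meet in the identity, so shifting applies to
    every matrix with columns in \<open>?\<eta>1\<close> and rows in
    \<open>?\<eta>0\<close>.\<close>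
  moreover have "centralizes \<Sigma> ?B ?\<eta>1 ?\<eta>0 ?\<Delta>"
  proof (rule centralizesI)
    fix p q r s
    assume mat: "mat \<Sigma> ?B ?\<eta>1 ?\<eta>0 (p, q) (r, s)" and pq: "(p, q) \<in> ?\<Delta>"
    note rc = mat_rows_columns[OF mat \<eta>(2,1), simplified]
    show "(r, s) \<in> ?\<Delta>"
    proof (rule shifting[OF B \<eta> \<Delta>])
      show "?\<eta>0 \<inter> ?\<eta>1 \<subseteq> ?\<Delta>"
        using Con_refl[OF \<Delta>] by (auto simp: pullback_def)
    qed (use rc pq in auto)
  qed
  ultimately have "centralizes \<Sigma> ?B (nabla ?B) ?\<eta>0 ?\<Delta>"
    using centralizes_below[OF \<Delta> \<eta>(1) \<Delta>] by (blast intro: centralizes_relcomp)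
  \<comment> \<open>With the places exchanged, the second full relation can be assembled in the same
    way, from \<open>?\<eta>0\<close> and \<open>?\<Delta>\<close>.\<close>
  then have "centralizes \<Sigma> ?B ?\<eta>0 (nabla ?B) ?\<Delta>"
    by (rule centralizes_commute[OF B \<nabla> \<eta>(1) \<Delta>])
  moreover have "nabla ?B \<subseteq> (?\<eta>0 O ?\<Delta>) O ?\<eta>0"
  proof
    fix w assume "w \<in> nabla ?B"
    then obtain x y u v where w: "w = ((x, y), (u, v))" "(x, y) \<in> \<theta>" "(u, v) \<in> \<theta>"
      by (auto simp: nabla_def)
    then have "((x, y), (x, x)) \<in> ?\<eta>0" "((u, u), (u, v)) \<in> ?\<eta>0" "((x, x), (u, u)) \<in> ?\<Delta>"
      using cr refl by (auto simp: pullback_iff intro!: diag)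
    then show "w \<in> (?\<eta>0 O ?\<Delta>) O ?\<eta>0"
      unfolding w(1) by blast
  qed
  ultimately have C': "centralizes \<Sigma> ?B (nabla ?B) (nabla ?B) ?\<Delta>"
    using centralizes_below[OF \<Delta> \<nabla> \<Delta>] by (blast intro: centralizes_relcomp)
  show ?thesis
  proof
    fix w assume "w \<in> \<theta>"
    moreover obtain x y where w: "w = (x, y)"
      by fastforce
    \<comment> \<open>As \<open>?\<Delta>\<close> is full, it links the diagonal to every pair of
      \<theta>; \<open>C\<close> then carries membership in \<delta> along this link.\<close>
    ultimately have "((x, x), (x, y)) \<in> ?\<Delta>"
      using cr refl by (intro perfect_nabla[OF B \<Delta> C']) auto
    moreover have "(x, x) \<in> \<delta>"
      using \<open>w \<in> \<theta>\<close> w cr Con_refl[OF con(2)] by blast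
    ultimately show "w \<in> \<delta>"
      using mat_con_centralizes[OF C _ _ ne] w by blast
  qed
qed

text \<open>The pairs \<open>(x, y)\<close> for which the conclusion holds form a congruence \<open>\<tau>\<close>, modulo which \<open>\<theta>\<close> is
  central.\<close>

lemma no_skew:
  assumes M: "M \<in> equational_class \<Sigma> E" and e: "inj_on (e :: 'c \<Rightarrow> 'u) (carrier M)"
    and con: "\<rho> \<in> Con \<Sigma> M" "\<sigma> \<in> Con \<Sigma> M" "\<theta> \<in> Con \<Sigma> M"
    and meet: "\<rho> \<inter> \<sigma> \<subseteq> Id" and comp: "nabla M \<subseteq> \<rho> O \<sigma>"
    and pts: "(x, y) \<in> \<theta>" "(x, x') \<in> \<rho>" "(y, y') \<in> \<rho>" "(x', y') \<in> \<sigma>"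
  shows "(x', y') \<in> \<theta>"
proof -
  have al: "is_algebra \<Sigma> M"
    using M by (rule equational_class_is_algebra)
  note cr = Con_carrierD[OF con(1)] Con_carrierD[OF con(2)] Con_carrierD[OF con(3)]
  note \<rho>r = Con_refl[OF con(1)] and \<rho>s = Con_sym[OF con(1)] and \<rho>t = Con_trans[OF con(1)]
    and \<sigma>r = Con_refl[OF con(2)] and \<sigma>s = Con_sym[OF con(2)] and \<sigma>t = Con_trans[OF con(2)]
    and \<theta>r = Con_refl[OF con(3)] and \<theta>s = Con_sym[OF con(3)] and \<theta>t = Con_trans[OF con(3)]
  have le: "\<rho> \<inter> \<sigma> \<subseteq> \<theta>"
  proof
    fix w assume w: "w \<in> \<rho> \<inter> \<sigma>"
    then have "w = (fst w, fst w)"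
      using meet by (auto simp: prod_eq_iff)
    moreover have "fst w \<in> carrier M"
      using cr(1)[of "fst w" "snd w"] w by simp
    ultimately show "w \<in> \<theta>"
      using \<theta>r by metis
  qed
  \<comment> \<open>Read \<rho> as equality in one coordinate and \<sigma> as equality in all
    others. Then \<open>shift\<close> alters the other coordinates of a pair that differs in the one
    coordinate, and \<open>shift'\<close> does the reverse.\<close>
  have shift: "(c, d) \<in> \<theta>"
    if "(a, b) \<in> \<sigma>" "(c, d) \<in> \<sigma>" "(a, c) \<in> \<rho>" "(b, d) \<in> \<rho>" "(a, b) \<in> \<theta>" for a b c d
    by (rule shifting[OF M e con(2,1,3) _ that]) (use le in auto)
  have shift': "(c, d) \<in> \<theta>"
    if "(a, b) \<in> \<rho>" "(c, d) \<in> \<rho>" "(a, c) \<in> \<sigma>" "(b, d) \<in> \<sigma>" "(a, b) \<in> \<theta>" for a b c d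
    by (rule shifting[OF M e con le that])
  have ex: "\<exists>z. (a, z) \<in> \<rho> \<and> (z, c) \<in> \<sigma>" if "a \<in> carrier M" "c \<in> carrier M" for a c
    using comp that by (auto simp: nabla_def)
  define \<tau> where "\<tau> = {(x, y). x \<in> carrier M \<and> y \<in> carrier M \<and>
    (\<forall>x' y'. (x, x') \<in> \<rho> \<and> (y, y') \<in> \<rho> \<and> (x', y') \<in> \<sigma> \<longrightarrow> (x', y') \<in> \<theta>)}"
  \<comment> \<open>By \<open>shift\<close>, one projected pair in \<theta> forces all of them into
    \<theta>, so the universal condition in \<tau> can be checked at a single instance.\<close>
  have \<tau>I: "(a, b) \<in> \<tau>" if a: "(a, a') \<in> \<rho>" and b: "(b, b') \<in> \<rho>" and "(a', b') \<in> \<sigma>" "(a', b') \<in> \<theta>"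
    for a b a' b'
  proof -
    have "(a'', b'') \<in> \<theta>" if "(a, a'') \<in> \<rho>" "(b, b'') \<in> \<rho>" "(a'', b'') \<in> \<sigma>" for a'' b''
      using \<open>(a', b') \<in> \<sigma>\<close> that(3) \<rho>t[OF \<rho>s[OF a] that(1)] \<rho>t[OF \<rho>s[OF b] that(2)] \<open>(a', b') \<in> \<theta>\<close>
      by (rule shift)
    then show ?thesis
      using cr(1)[OF a] cr(1)[OF b] by (simp add: \<tau>_def)
  qed
  have \<tau>D: "(a', b') \<in> \<theta>" if "(a, b) \<in> \<tau>" "(a, a') \<in> \<rho>" "(b, b') \<in> \<rho>" "(a', b') \<in> \<sigma>" for a b a' b'
    using that unfolding \<tau>_def by blast
  have \<tau>c: "a \<in> carrier M" "b \<in> carrier M" if "(a, b) \<in> \<tau>" for a b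
    using that unfolding \<tau>_def by blast+
  have \<rho>\<tau>: "\<rho> \<subseteq> \<tau>"
  proof
    fix w assume w: "w \<in> \<rho>"
    obtain a b where ab: "w = (a, b)"
      by fastforce
    then have "b \<in> carrier M"
      using w cr(2) by blast
    then show "w \<in> \<tau>"
      using \<tau>I[of a b b b] w \<rho>r \<sigma>r \<theta>r ab by simp
  qed
  have \<tau>: "\<tau> \<in> Con \<Sigma> M"
  proof (rule ConI)
    show \<tau>sub: "\<tau> \<subseteq> carrier M \<times> carrier M"
      using \<tau>c by auto
    show "(a, a) \<in> \<tau>" if "a \<in> carrier M" for a
      using \<rho>r[OF that] \<rho>\<tau> by blast
    show "(b, a) \<in> \<tau>" if ab: "(a, b) \<in> \<tau>" for a b
    proof -
      obtain b' where b': "(b, b') \<in> \<rho>" "(b', a) \<in> \<sigma>"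
        using ex \<tau>c[OF ab] by blast
      have "(a, b') \<in> \<theta>"
        using \<tau>D[OF ab \<rho>r[OF \<tau>c(1)[OF ab]] b'(1) \<sigma>s[OF b'(2)]] .
      then show ?thesis
        using \<tau>I[OF b'(1) \<rho>r[OF \<tau>c(1)[OF ab]] b'(2) \<theta>s] by simp
    qed
    show "(a, c) \<in> \<tau>" if ab: "(a, b) \<in> \<tau>" and bc: "(b, c) \<in> \<tau>" for a b c
    proof -
      have a: "(a, a) \<in> \<rho>"
        using \<rho>r[OF \<tau>c(1)[OF ab]] .
      obtain b' where b': "(b, b') \<in> \<rho>" "(b', a) \<in> \<sigma>"
        using ex \<tau>c[OF ab] by blast
      obtain c' where c': "(c, c') \<in> \<rho>" "(c', a) \<in> \<sigma>"
        using ex[OF \<tau>c(2)[OF bc] \<tau>c(1)[OF ab]] by blast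
      have "(a, b') \<in> \<theta>"
        using \<tau>D[OF ab a b'(1) \<sigma>s[OF b'(2)]] .
      moreover have "(b', c') \<in> \<theta>"
        using \<tau>D[OF bc b'(1) c'(1) \<sigma>t[OF b'(2) \<sigma>s[OF c'(2)]]] .
      ultimately show ?thesis
        using \<tau>I[OF a c'(1) \<sigma>s[OF c'(2)] \<theta>t] by blast
    qed
    fix g as bs
    assume g: "\<Sigma> g = Some (length as)" and l: "list_all2 (\<lambda>x y. (x, y) \<in> \<tau>) as bs"
    obtain c where c: "c \<in> carrier M"
      using al by (auto simp: is_algebra_def)
    \<comment> \<open>\<open>k\<close> projects every argument along \<rho> into the \<sigma>-class
      of the fixed element \<open>c\<close>; the operation is then applied to these
      projections.\<close>
    define k where "k = (\<lambda>a. SOME z. (a, z) \<in> \<rho> \<and> (z, c) \<in> \<sigma>)"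
    have k: "(a, k a) \<in> \<rho>" "(k a, c) \<in> \<sigma>" if "a \<in> carrier M" for a
      using someI_ex[OF ex[OF that c]] by (auto simp: k_def)
    have ks: "(k a, k b) \<in> \<sigma>" if "(a, b) \<in> \<tau>" for a b
      using \<sigma>t[OF k(2) \<sigma>s[OF k(2)]] \<tau>c[OF that] by blast
    have "list_all2 (\<lambda>x y. (x, y) \<in> \<theta>) (map k as) (map k bs)"
      using l \<tau>D[OF _ k(1) k(1) ks] \<tau>c by (fastforce simp: list_all2_conv_all_nth)
    moreover have "list_all2 (\<lambda>x y. (x, y) \<in> \<sigma>) (map k as) (map k bs)"
      using l ks by (simp add: list_all2_conv_all_nth)
    moreover have "list_all2 (\<lambda>x y. (x, y) \<in> \<rho>) as (map k as)"
       "list_all2 (\<lambda>x y. (x, y) \<in> \<rho>) bs (map k bs)"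
      using list_all2_subset_carrier[OF l \<tau>sub] k(1)
      by (auto simp: list.rel_map list_all2_same)
    ultimately show "(oper M g as, oper M g bs) \<in> \<tau>"
      using con g list_all2_lengthD[OF l]
      by (intro \<tau>I[of _ "oper M g (map k as)" _ "oper M g (map k bs)"])
        (auto intro!: Con_oper[where \<Sigma> = \<Sigma>])
  qed
  have "centralizes \<Sigma> M \<sigma> \<theta> \<tau>"
  proof (rule centralizesI)
    fix p q r s
    assume mat: "mat \<Sigma> M \<sigma> \<theta> (p, q) (r, s)" and pq: "(p, q) \<in> \<tau>"
    note rc = mat_rows_columns[OF mat con(2,3), simplified]
    \<comment> \<open>\<open>q'\<close> and \<open>s'\<close> are the projections of
      \<open>q\<close> and \<open>s\<close> to the \<sigma>-class of \<open>p\<close>, which also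
      contains \<open>r\<close>. From \<open>(q', q)\<close> in \<theta>, \<open>shift'\<close>
      yields \<open>(s', s)\<close> in \<theta>.\<close>
    obtain q' where q': "(q, q') \<in> \<rho>" "(q', p) \<in> \<sigma>"
      using ex \<tau>c[OF pq] by blast
    obtain s' where s': "(s, s') \<in> \<rho>" "(s', p) \<in> \<sigma>"
      using ex[OF cr(6)[OF rc(2)] \<tau>c(1)[OF pq]] by blast
    have "(p, q') \<in> \<theta>"
      using \<tau>D[OF pq \<rho>r[OF \<tau>c(1)[OF pq]] q'(1) \<sigma>s[OF q'(2)]] .
    then have "(q', q) \<in> \<theta>"
      using \<theta>t[OF \<theta>s rc(1)] by blast
    then have "(s', s) \<in> \<theta>"
      using shift'[OF \<rho>s[OF q'(1)] \<rho>s[OF s'(1)] \<sigma>t[OF q'(2) \<sigma>s[OF s'(2)]] rc(4)] by blast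
    then have "(r, s') \<in> \<theta>"
      using \<theta>t[OF rc(2) \<theta>s] by blast
    moreover have "(r, s') \<in> \<sigma>"
      using \<sigma>s[OF \<sigma>t[OF s'(2) rc(3)]] .
    ultimately show "(r, s) \<in> \<tau>"
      using \<tau>I[OF \<rho>r[OF cr(5)[OF rc(2)]] s'(1)] by blast
  qed
  \<comment> \<open>The full relation is composed of \<rho>, which lies below \<tau>, and \<sigma>,
    just treated.\<close>
  then have "centralizes \<Sigma> M (nabla M) \<theta> \<tau>"
    using centralizes_below[OF con(1,3) \<tau> \<rho>\<tau>] comp by (blast intro: centralizes_relcomp)
  then have "\<theta> \<subseteq> \<tau>"
    by (rule perfect_central[OF M e con(3) \<tau>])
  then show ?thesis
    using \<tau>D[of x y x' y'] pts by blast
qed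

end

section \<open>Finite products\<close>

lemma prod_algebra_simps [simp]:
  "carrier (prod_algebra I M) = (\<Pi>\<^sub>E i\<in>I. carrier (M i))"
  "oper (prod_algebra I M) g xs = (\<lambda>i\<in>I. oper (M i) g (map (\<lambda>x. x i) xs))"
  by (simp_all add: prod_algebra_def)

lemma prod_algebra_is_algebra:
  assumes "\<And>i. i \<in> I \<Longrightarrow> is_algebra \<Sigma> (M i)"
  shows "is_algebra \<Sigma> (prod_algebra I M)"
  unfolding is_algebra_def
proof (intro conjI allI impI)
  show "carrier (prod_algebra I M) \<noteq> {}"
    using assms by (auto simp: is_algebra_def PiE_eq_empty_iff)
  fix g as
  assume *: "\<Sigma> g = Some (length as) \<and> set as \<subseteq> carrier (prod_algebra I M)"
  have "oper (M i) g (map (\<lambda>x. x i) as) \<in> carrier (M i)" if "i \<in> I" for i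
    using * assms[OF that] that by (intro is_algebra_oper[where \<Sigma> = \<Sigma>]) auto
  then show "oper (prod_algebra I M) g as \<in> carrier (prod_algebra I M)"
    by auto
qed

lemma morphism_projection: "i \<in> I \<Longrightarrow> morphism \<Sigma> (prod_algebra I M) (M i) (\<lambda>x. x i)"
  by (auto simp: morphism_def)

lemma prod_algebra_class:
  assumes "wf_equations \<Sigma> E" "\<And>i. i \<in> I \<Longrightarrow> M i \<in> equational_class \<Sigma> E"
  shows "prod_algebra I M \<in> equational_class \<Sigma> E"
proof (rule equational_class_jointly_injective[OF assms(1), where I = I and Q = M and h = "\<lambda>i x. x i"])
  show "is_algebra \<Sigma> (prod_algebra I M)"
    using assms(2) by (intro prod_algebra_is_algebra equational_class_is_algebra)
qed (use assms(2) in \<open>auto intro: morphism_projection PiE_ext\<close>)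

section \<open>Congruences of a product that constrain a single coordinate\<close>

abbreviation cylinder :: "'i set \<Rightarrow> ('i \<Rightarrow> ('f, 'a) algebra) \<Rightarrow> 'i \<Rightarrow> 'a rel \<Rightarrow> ('i \<Rightarrow> 'a) rel" where
  "cylinder I M i \<theta> \<equiv> pullback (prod_algebra I M) (\<lambda>x. x i) \<theta>"

text \<open>A pair of \<alpha> is realised in the product by inserting its entries at
  \<open>i\<close> into the fixed tuple \<open>z\<close>.\<close>

lemma cylinder_subset_iff:
  assumes z: "z \<in> carrier (prod_algebra I M)" and i: "i \<in> I" and \<alpha>: "\<alpha> \<subseteq> nabla (M i)"
  shows "cylinder I M i \<alpha> \<subseteq> cylinder I M i \<beta> \<longleftrightarrow> \<alpha> \<subseteq> \<beta>"
proof
  assume *: "cylinder I M i \<alpha> \<subseteq> cylinder I M i \<beta>"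
  show "\<alpha> \<subseteq> \<beta>"
  proof
    fix w assume w: "w \<in> \<alpha>"
    obtain a b where ab: "w = (a, b)"
      by fastforce
    have "z(i := a) \<in> carrier (prod_algebra I M)" "z(i := b) \<in> carrier (prod_algebra I M)"
      using w ab \<alpha> z i by (auto simp: nabla_def PiE_iff extensional_def)
    then have "(z(i := a), z(i := b)) \<in> cylinder I M i \<alpha>"
      using w ab by (simp add: pullback_iff del: prod_algebra_simps)
    then have "(z(i := a), z(i := b)) \<in> cylinder I M i \<beta>"
      using * by blast
    then show "w \<in> \<beta>"
      using ab by (simp add: pullback_iff)
  qed
qed (auto simp: pullback_iff)

lemma cylinder_nabla: "i \<in> I \<Longrightarrow> cylinder I M i (nabla (M i)) = nabla (prod_algebra I M)"
  by (auto simp: pullback_def nabla_def)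

text \<open>If the indices differed, tuples differing only at \<open>j\<close> would agree at
  \<open>i\<close> and so lie in the first cylinder, which would make \<beta> full.\<close>

lemma cylinder_index_unique:
  assumes z: "z \<in> carrier (prod_algebra I M)" and ij: "i \<in> I" "j \<in> I"
    and \<alpha>: "\<alpha> \<in> Con \<Sigma> (M i)" and \<beta>: "\<beta> \<in> Con \<Sigma> (M j)" "\<beta> \<noteq> nabla (M j)"
    and sub: "cylinder I M i \<alpha> \<subseteq> cylinder I M j \<beta>"
  shows "i = j"
proof (rule ccontr)
  assume ne: "i \<noteq> j"
  have "nabla (M j) \<subseteq> \<beta>"
  proof
    fix w assume "w \<in> nabla (M j)"
    then obtain a b where ab: "w = (a, b)" "a \<in> carrier (M j)" "b \<in> carrier (M j)"
      by (auto simp: nabla_def)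
    have "z i \<in> carrier (M i)"
      using z ij by auto
    then have "(z(j := a), z(j := b)) \<in> cylinder I M i \<alpha>"
      using ab z ij ne Con_refl[OF \<alpha>] by (auto simp: pullback_iff PiE_iff extensional_def)
    then have "(z(j := a), z(j := b)) \<in> cylinder I M j \<beta>"
      using sub by blast
    then show "w \<in> \<beta>"
      using ab by (simp add: pullback_iff)
  qed
  then show False
    using \<beta> Con_carrier unfolding nabla_def by blast
qed

lemma Spec_Con: "\<phi> \<in> Spec \<Sigma> M \<Longrightarrow> \<phi> \<in> Con \<Sigma> M"
  by (simp add: Spec_def)

lemma Spec_not_nabla: "\<phi> \<in> Spec \<Sigma> M \<Longrightarrow> \<phi> \<noteq> nabla M"
  by (simp add: Spec_def)

lemma Con_subset_nabla: "\<phi> \<in> Con \<Sigma> M \<Longrightarrow> \<phi> \<subseteq> nabla M"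
  by (auto simp: nabla_def dest: Con_carrierD)

lemma commutator_le_Int:
  "\<alpha> \<in> Con \<Sigma> M \<Longrightarrow> \<beta> \<in> Con \<Sigma> M \<Longrightarrow> commutator \<Sigma> M \<alpha> \<beta> \<subseteq> \<alpha> \<inter> \<beta>"
  by (intro commutator_le Con_Int centralizes_Int)

section \<open>Projections of congruences of a finite product\<close>

locale perfect_modular_product = perfect_modular_class \<Sigma> E pair
  for \<Sigma> :: "'f signature" and E :: "'f equations" and pair :: "'u \<Rightarrow> 'u \<Rightarrow> 'u" +
  fixes I :: "'i set" and M :: "'i \<Rightarrow> ('f, 'a) algebra" and e :: "('i \<Rightarrow> 'a) \<Rightarrow> 'u"
  assumes finite_index: "finite I"
    and factor_class: "\<And>i. i \<in> I \<Longrightarrow> M i \<in> equational_class \<Sigma> E"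
    and e_inj: "inj_on e (carrier (prod_algebra I M))"
begin

abbreviation PM where "PM \<equiv> prod_algebra I M"

lemma factor_algebra: "i \<in> I \<Longrightarrow> is_algebra \<Sigma> (M i)"
  using factor_class equational_class_is_algebra by blast

lemma PM_class: "PM \<in> equational_class \<Sigma> E"
  using wf_eqs factor_class by (rule prod_algebra_class)

lemma PM_algebra: "is_algebra \<Sigma> PM"
  using PM_class by (rule equational_class_is_algebra)

lemma PM_nonempty: obtains z where "z \<in> carrier PM"
  using PM_algebra by (auto simp: is_algebra_def)

lemma PM_update: "z \<in> carrier PM \<Longrightarrow> i \<in> I \<Longrightarrow> a \<in> carrier (M i) \<Longrightarrow> z(i := a) \<in> carrier PM"
  by (auto simp: PiE_iff extensional_def)

lemma cylinder_Con: "i \<in> I \<Longrightarrow> \<theta> \<in> Con \<Sigma> (M i) \<Longrightarrow> cylinder I M i \<theta> \<in> Con \<Sigma> PM"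
  by (rule Con_pullback[OF PM_algebra morphism_projection])

definition ker :: "'i \<Rightarrow> ('i \<Rightarrow> 'a) rel" where
  "ker i = cylinder I M i (Id_on (carrier (M i)))"

lemma ker_iff: "i \<in> I \<Longrightarrow> (x, y) \<in> ker i \<longleftrightarrow> x \<in> carrier PM \<and> y \<in> carrier PM \<and> x i = y i"
  by (auto simp: ker_def pullback_iff)

lemma ker_Con: "i \<in> I \<Longrightarrow> ker i \<in> Con \<Sigma> PM"
  unfolding ker_def using factor_algebra by (intro cylinder_Con Con_Id_on)

text \<open>The empty meet is the full relation, where the induction over sets of kernels
  starts.\<close>

definition meet_ker :: "'i set \<Rightarrow> ('i \<Rightarrow> 'a) rel" where
  "meet_ker J = {(x, y). x \<in> carrier PM \<and> y \<in> carrier PM \<and> (\<forall>j\<in>J. x j = y j)}"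

lemma meet_ker_eq: "J \<subseteq> I \<Longrightarrow> meet_ker J = \<Inter>(insert (nabla PM) (ker ` J))"
  by (auto simp: meet_ker_def nabla_def ker_iff subset_iff simp del: prod_algebra_simps)

lemma meet_ker_Con:
  assumes "J \<subseteq> I"
  shows "meet_ker J \<in> Con \<Sigma> PM"
  unfolding meet_ker_eq[OF assms] using assms
  by (intro Con_Inter) (auto intro: Con_nabla PM_algebra ker_Con)

text \<open>By \<open>component_memI\<close>, this is the projection of a congruence \<theta> to
  coordinate \<open>i\<close>. Quantifying over all completions \<open>z\<close> lets transitivity
  be inherited from \<theta> directly.\<close>

definition component :: "'i \<Rightarrow> ('i \<Rightarrow> 'a) rel \<Rightarrow> 'a rel" where
  "component i \<theta> = {(a, b). a \<in> carrier (M i) \<and> b \<in> carrier (M i) \<and>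
     (\<forall>z\<in>carrier PM. (z(i := a), z(i := b)) \<in> \<theta>)}"

text \<open>\<open>no_skew\<close> moves the pair to the other coordinates of an arbitrary
  \<open>z\<close>; the complementary congruences are the kernel of projection \<open>i\<close> and
  the meet of the remaining kernels.\<close>

lemma component_memI:
  assumes i: "i \<in> I" and \<theta>: "\<theta> \<in> Con \<Sigma> PM" and xy: "(x, y) \<in> \<theta>"
  shows "(x i, y i) \<in> component i \<theta>"
proof -
  have cr: "x \<in> carrier PM" "y \<in> carrier PM"
    using Con_carrierD[OF \<theta> xy] by auto
  then have cri: "x i \<in> carrier (M i)" "y i \<in> carrier (M i)"
    using i by auto
  have "(z(i := x i), z(i := y i)) \<in> \<theta>" if z: "z \<in> carrier PM" for z
  proof (rule no_skew[OF PM_class e_inj ker_Con[OF i] meet_ker_Con \<theta> _ _ xy])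
    show "I - {i} \<subseteq> I"
      by blast
    show "ker i \<inter> meet_ker (I - {i}) \<subseteq> Id"
    proof
      fix w assume "w \<in> ker i \<inter> meet_ker (I - {i})"
      then obtain x y where w: "w = (x, y)" "x \<in> carrier PM" "y \<in> carrier PM"
        and eq: "x i = y i" "\<forall>j\<in>I - {i}. x j = y j"
        using i by (auto simp: ker_iff meet_ker_def)
      have "x j = y j" if "j \<in> I" for j
        using eq that by (cases "j = i") auto
      then have "x = y"
        using w by (auto intro: PiE_ext)
      then show "w \<in> Id"
        using w by simp
    qed
    show "nabla PM \<subseteq> ker i O meet_ker (I - {i})"
    proof
      fix w assume "w \<in> nabla PM"
      then obtain x y where w: "w = (x, y)" "x \<in> carrier PM" "y \<in> carrier PM"
        by (auto simp: nabla_def)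
      have "x i \<in> carrier (M i)"
        using w i by auto
      then have "(x, y(i := x i)) \<in> ker i" "(y(i := x i), y) \<in> meet_ker (I - {i})"
        using w i PM_update by (auto simp: ker_iff meet_ker_def simp del: prod_algebra_simps)
      then show "w \<in> ker i O meet_ker (I - {i})"
        using w by blast
    qed
  qed (use cr cri z i PM_update in \<open>auto simp: ker_iff meet_ker_def simp del: prod_algebra_simps\<close>)
  then show ?thesis
    using cri by (simp add: component_def)
qed

lemma component_Con:
  assumes i: "i \<in> I" and \<theta>: "\<theta> \<in> Con \<Sigma> PM"
  shows "component i \<theta> \<in> Con \<Sigma> (M i)"
proof (rule ConI)
  show "component i \<theta> \<subseteq> carrier (M i) \<times> carrier (M i)"
    by (auto simp: component_def)
  show "(a, a) \<in> component i \<theta>" if "a \<in> carrier (M i)" for a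
    using that i PM_update Con_refl[OF \<theta>] by (simp add: component_def del: prod_algebra_simps)
  show "(b, a) \<in> component i \<theta>" if "(a, b) \<in> component i \<theta>" for a b
    using that Con_sym[OF \<theta>] by (simp add: component_def del: prod_algebra_simps)
  show "(a, c) \<in> component i \<theta>" if "(a, b) \<in> component i \<theta>" "(b, c) \<in> component i \<theta>" for a b c
    using that Con_trans[OF \<theta>] unfolding component_def by blast
  fix g as bs
  assume g: "\<Sigma> g = Some (length as)" and l: "list_all2 (\<lambda>x y. (x, y) \<in> component i \<theta>) as bs"
  obtain z where z: "z \<in> carrier PM"
    by (rule PM_nonempty)
  have "list_all2 (\<lambda>x y. (x, y) \<in> \<theta>) (map (\<lambda>a. z(i := a)) as) (map (\<lambda>a. z(i := a)) bs)"
    using l z by (simp add: list_all2_conv_all_nth component_def del: prod_algebra_simps)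
  then have "(oper PM g (map (\<lambda>a. z(i := a)) as), oper PM g (map (\<lambda>a. z(i := a)) bs)) \<in> \<theta>"
    using g by (intro Con_oper[OF \<theta>]) auto
  \<comment> \<open>Off \<open>i\<close> the two results agree, but their entries there are
    \<open>g\<close> applied to copies of those of \<open>z\<close>; \<open>component_memI\<close>
    makes the choice of these entries immaterial.\<close>
  from component_memI[OF i \<theta> this] show "(oper (M i) g as, oper (M i) g bs) \<in> component i \<theta>"
    using i by (simp add: comp_def)
qed

text \<open>The tuples are lifted by insertion into a fixed \<open>z\<close>; at the other
  coordinates the value of a term depends on \<open>z\<close> alone.\<close>

lemma component_centralizes:
  assumes i: "i \<in> I" and con: "\<alpha> \<in> Con \<Sigma> PM" "\<beta> \<in> Con \<Sigma> PM" "\<delta> \<in> Con \<Sigma> PM"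
    and C: "centralizes \<Sigma> PM \<alpha> \<beta> \<delta>"
  shows "centralizes \<Sigma> (M i) (component i \<alpha>) (component i \<beta>) (component i \<delta>)"
  unfolding centralizes_def
proof (intro allI impI, elim conjE)
  fix t :: "('f, nat + nat) trm" and a b c d
  assume t: "wf_trm \<Sigma> t" and ab: "\<forall>k. (a k, b k) \<in> component i \<alpha>"
    and cd: "\<forall>k. (c k, d k) \<in> component i \<beta>"
    and *: "(eval_trm (M i) (case_sum a c) t, eval_trm (M i) (case_sum a d) t) \<in> component i \<delta>"
  obtain z where z: "z \<in> carrier PM"
    by (rule PM_nonempty)
  let ?u = "\<lambda>x k. z(i := x k)"
  let ?t = "\<lambda>x y. eval_trm PM (case_sum (?u x) (?u y)) t"
  have rg: "range (case_sum (?u x) (?u y)) \<subseteq> carrier PM" if "x \<in> {a, b}" "y \<in> {c, d}" for x y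
    using that ab cd i PM_update[OF z]
    by (auto simp: component_def split: sum.splits simp del: prod_algebra_simps)
  have ev: "?t x y j = eval_trm (M j) (\<lambda>v. case_sum (?u x) (?u y) v j) t"
    if "x \<in> {a, b}" "y \<in> {c, d}" "j \<in> I" for x y j
    using eval_trm_morphism[OF PM_algebra morphism_projection[OF that(3)] rg[OF that(1,2)] t]
    by (simp add: comp_def)
  have evi: "?t x y i = eval_trm (M i) (case_sum x y) t" if "x \<in> {a, b}" "y \<in> {c, d}" for x y
  proof -
    have "(\<lambda>v. case_sum (?u x) (?u y) v i) = case_sum x y"
      by (auto simp: fun_eq_iff split: sum.splits)
    then show ?thesis
      using ev[OF that i] by simp
  qed
  have evj: "?t x y j = eval_trm (M j) (\<lambda>_. z j) t"
    if "x \<in> {a, b}" "y \<in> {c, d}" "j \<in> I" "j \<noteq> i" for x y j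
  proof -
    have "(\<lambda>v. case_sum (?u x) (?u y) v j) = (\<lambda>_. z j)"
      using that(4) by (auto simp: fun_eq_iff split: sum.splits)
    then show ?thesis
      using ev[OF that(1-3)] by simp
  qed
  have cr: "?t x y \<in> carrier PM" if "x \<in> {a, b}" "y \<in> {c, d}" for x y
    using eval_trm_carrier[OF PM_algebra rg[OF that] t] .
  \<comment> \<open>The lifted values differ at most at \<open>i\<close>, so membership in the
    component of \<delta> can be used with \<open>?t a c\<close> as the completion.\<close>
  have "(?t a c)(i := eval_trm (M i) (case_sum a d) t) = ?t a d"
    by (rule PiE_ext[of _ I "\<lambda>i. carrier (M i)"])
      (use cr[of a d] cr[of a c] i evi evj * in \<open>auto simp: component_def PiE_iff extensional_def\<close>)
  moreover have "(?t a c)(i := eval_trm (M i) (case_sum a c) t) = ?t a c"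
    using evi[of a c] by (simp add: fun_eq_iff)
  moreover have "((?t a c)(i := eval_trm (M i) (case_sum a c) t),
      (?t a c)(i := eval_trm (M i) (case_sum a d) t)) \<in> \<delta>"
    using * cr[of a c] unfolding component_def by blast
  ultimately have "(?t a c, ?t a d) \<in> \<delta>"
    by (simp only:)
  moreover have "\<forall>k. (?u a k, ?u b k) \<in> \<alpha>" "\<forall>k. (?u c k, ?u d k) \<in> \<beta>"
    using ab cd z by (auto simp: component_def simp del: prod_algebra_simps)
  ultimately have "(?t b c, ?t b d) \<in> \<delta>"
    using t C[unfolded centralizes_def, rule_format, of t "?u a" "?u b" "?u c" "?u d"] by blast
  from component_memI[OF i con(3) this]
  show "(eval_trm (M i) (case_sum b c) t, eval_trm (M i) (case_sum b d) t) \<in> component i \<delta>"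
    by (simp add: evi)
qed

lemma subset_cylinder_component:
  assumes "i \<in> I" "\<theta> \<in> Con \<Sigma> PM"
  shows "\<theta> \<subseteq> cylinder I M i (component i \<theta>)"
proof
  fix w assume w: "w \<in> \<theta>"
  obtain x y where xy: "w = (x, y)"
    by fastforce
  show "w \<in> cylinder I M i (component i \<theta>)"
    using component_memI[OF assms] Con_carrierD[OF assms(2)] w xy
    by (simp add: pullback_iff del: prod_algebra_simps)
qed

lemma component_subset:
  assumes "i \<in> I" "\<theta> \<subseteq> cylinder I M i \<phi>"
  shows "component i \<theta> \<subseteq> \<phi>"
proof
  fix w assume w: "w \<in> component i \<theta>"
  obtain a b where ab: "w = (a, b)"
    by fastforce
  obtain z where "z \<in> carrier PM"
    by (rule PM_nonempty)
  then have "(z(i := a), z(i := b)) \<in> \<theta>"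
    using w ab by (simp add: component_def del: prod_algebra_simps)
  then show "w \<in> \<phi>"
    using assms ab by (auto simp: pullback_iff)
qed

text \<open>First coordinate \<open>i\<close> is changed by means of the component, then all others
  by means of \<open>ker i\<close>.\<close>

lemma cylinder_component:
  assumes i: "i \<in> I" and \<theta>: "\<theta> \<in> Con \<Sigma> PM" and ker: "ker i \<subseteq> \<theta>"
  shows "cylinder I M i (component i \<theta>) = \<theta>"
proof
  show "cylinder I M i (component i \<theta>) \<subseteq> \<theta>"
  proof
    fix w assume w: "w \<in> cylinder I M i (component i \<theta>)"
    obtain x y where xy: "w = (x, y)"
      by fastforce
    have cr: "x \<in> carrier PM" "y \<in> carrier PM" "y i \<in> carrier (M i)"
      and "(x i, y i) \<in> component i \<theta>"
      using w xy i by (auto simp: pullback_iff)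
    then have "(x(i := x i), x(i := y i)) \<in> \<theta>"
      unfolding component_def by blast
    moreover have "(x(i := y i), y) \<in> ker i"
      using cr i PM_update by (simp add: ker_iff del: prod_algebra_simps)
    ultimately show "w \<in> \<theta>"
      using Con_trans[OF \<theta>] ker xy by auto
  qed
qed (rule subset_cylinder_component[OF i \<theta>])

section \<open>Prime congruences of a finite product\<close>

text \<open>Congruences pass up by cylinders and down by \<open>component\<close>. Both passages
  preserve the centralizing condition, so commutators are compared in both directions.\<close>

lemma cylinder_Spec_iff:
  assumes i: "i \<in> I" and \<phi>: "\<phi> \<in> Con \<Sigma> (M i)"
  shows "cylinder I M i \<phi> \<in> Spec \<Sigma> PM \<longleftrightarrow> \<phi> \<in> Spec \<Sigma> (M i)"
proof -
  obtain z where z: "z \<in> carrier PM"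
    by (rule PM_nonempty)
  note sub_iff = cylinder_subset_iff[OF z i]
  have nab: "nabla (M i) \<in> Con \<Sigma> (M i)"
    using factor_algebra[OF i] by (rule Con_nabla)
  have "cylinder I M i \<phi> = nabla PM \<longleftrightarrow> \<phi> = nabla (M i)"
    using sub_iff[of \<phi> "nabla (M i)"] sub_iff[of "nabla (M i)" \<phi>] Con_subset_nabla[OF \<phi>]
      cylinder_nabla[OF i, of M] by auto
  moreover have "(\<forall>\<alpha>\<in>Con \<Sigma> PM. \<forall>\<beta>\<in>Con \<Sigma> PM. commutator \<Sigma> PM \<alpha> \<beta> \<subseteq> cylinder I M i \<phi>
      \<longrightarrow> \<alpha> \<subseteq> cylinder I M i \<phi> \<or> \<beta> \<subseteq> cylinder I M i \<phi>) \<longleftrightarrow>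
    (\<forall>\<alpha>\<in>Con \<Sigma> (M i). \<forall>\<beta>\<in>Con \<Sigma> (M i). commutator \<Sigma> (M i) \<alpha> \<beta> \<subseteq> \<phi> \<longrightarrow> \<alpha> \<subseteq> \<phi> \<or> \<beta> \<subseteq> \<phi>)"
    (is "?L \<longleftrightarrow> ?R")
  proof
    assume L: ?L
    show ?R
    proof (intro ballI impI)
      fix \<alpha> \<beta>
      assume con: "\<alpha> \<in> Con \<Sigma> (M i)" "\<beta> \<in> Con \<Sigma> (M i)" and c: "commutator \<Sigma> (M i) \<alpha> \<beta> \<subseteq> \<phi>"
      let ?\<delta> = "commutator \<Sigma> (M i) \<alpha> \<beta>"
      have "commutator \<Sigma> PM (cylinder I M i \<alpha>) (cylinder I M i \<beta>) \<subseteq> cylinder I M i ?\<delta>"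
        using commutator_Con[OF factor_algebra[OF i] con]
        by (intro commutator_le cylinder_Con i centralizes_pullback[OF PM_algebra morphism_projection[OF i]]
            centralizes_commutator)
      also have "\<dots> \<subseteq> cylinder I M i \<phi>"
        using c by (auto simp: pullback_iff)
      finally have "cylinder I M i \<alpha> \<subseteq> cylinder I M i \<phi> \<or> cylinder I M i \<beta> \<subseteq> cylinder I M i \<phi>"
        using L cylinder_Con[OF i] con by blast
      then show "\<alpha> \<subseteq> \<phi> \<or> \<beta> \<subseteq> \<phi>"
        using sub_iff Con_subset_nabla con by blast
    qed
  next
    assume R: ?R
    show ?L
    proof (intro ballI impI)
      fix \<alpha> \<beta>
      assume con: "\<alpha> \<in> Con \<Sigma> PM" "\<beta> \<in> Con \<Sigma> PM" and c: "commutator \<Sigma> PM \<alpha> \<beta> \<subseteq> cylinder I M i \<phi>"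
      have \<delta>: "commutator \<Sigma> PM \<alpha> \<beta> \<in> Con \<Sigma> PM"
        using PM_algebra con by (rule commutator_Con)
      have "commutator \<Sigma> (M i) (component i \<alpha>) (component i \<beta>) \<subseteq> component i (commutator \<Sigma> PM \<alpha> \<beta>)"
        by (intro commutator_le component_Con i \<delta> component_centralizes con centralizes_commutator)
      also have "\<dots> \<subseteq> \<phi>"
        using i c by (rule component_subset)
      finally have "component i \<alpha> \<subseteq> \<phi> \<or> component i \<beta> \<subseteq> \<phi>"
        using R component_Con[OF i] con by blast
      then have "cylinder I M i (component i \<alpha>) \<subseteq> cylinder I M i \<phi>
          \<or> cylinder I M i (component i \<beta>) \<subseteq> cylinder I M i \<phi>"
        by (auto simp: pullback_iff)
      then show "\<alpha> \<subseteq> cylinder I M i \<phi> \<or> \<beta> \<subseteq> cylinder I M i \<phi>"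
        using subset_cylinder_component[OF i] con by blast
    qed
  qed
  ultimately show ?thesis
    using \<phi> cylinder_Con[OF i \<phi>] by (simp add: Spec_def)
qed

text \<open>The meet of all kernels is the identity. As the commutator is below the meet, primality
  splits off one kernel at a time.\<close>

lemma Spec_contains_ker:
  assumes \<psi>: "\<psi> \<in> Spec \<Sigma> PM"
  shows "\<exists>i\<in>I. ker i \<subseteq> \<psi>"
proof -
  have "\<exists>i\<in>J. ker i \<subseteq> \<psi>" if "finite J" "J \<subseteq> I" "meet_ker J \<subseteq> \<psi>" for J
    using that
  proof (induction J rule: finite_induct)
    case empty
    then have "nabla PM \<subseteq> \<psi>"
      by (auto simp: meet_ker_def nabla_def)
    then show ?case
      using Con_subset_nabla[OF Spec_Con[OF \<psi>]] Spec_not_nabla[OF \<psi>] by blast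
  next
    case (insert j J)
    have con: "meet_ker J \<in> Con \<Sigma> PM" "ker j \<in> Con \<Sigma> PM"
      using insert.prems by (auto intro: meet_ker_Con ker_Con)
    have "commutator \<Sigma> PM (meet_ker J) (ker j) \<subseteq> meet_ker J \<inter> ker j"
      using con by (rule commutator_le_Int)
    also have "\<dots> \<subseteq> meet_ker (insert j J)"
      using insert.prems by (auto simp: meet_ker_def ker_iff simp del: prod_algebra_simps)
    also have "\<dots> \<subseteq> \<psi>"
      by (rule insert.prems)
    finally have "meet_ker J \<subseteq> \<psi> \<or> ker j \<subseteq> \<psi>"
      using \<psi> con by (simp add: Spec_def)
    then show ?case
      using insert by blast
  qed
  moreover have "meet_ker I \<subseteq> \<psi>"
  proof
    fix w assume "w \<in> meet_ker I"
    then have "fst w = snd w" "fst w \<in> carrier PM"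
      by (auto simp: meet_ker_def intro!: PiE_ext[of _ I "\<lambda>i. carrier (M i)"])
    then show "w \<in> \<psi>"
      using Con_refl[OF Spec_Con[OF \<psi>]] by (metis prod.collapse)
  qed
  ultimately show ?thesis
    using finite_index by blast
qed

text \<open>A kernel below \<psi> makes \<psi> the cylinder over its component, and
  \<open>cylinder_Spec_iff\<close> passes primality down.\<close>

lemma Spec_cylinder:
  assumes "\<psi> \<in> Spec \<Sigma> PM"
  obtains i \<phi> where "i \<in> I" "\<phi> \<in> Spec \<Sigma> (M i)" "\<psi> = cylinder I M i \<phi>"
proof -
  obtain i where i: "i \<in> I" "ker i \<subseteq> \<psi>"
    using Spec_contains_ker[OF assms] by blast
  have "cylinder I M i (component i \<psi>) = \<psi>"
    using i Spec_Con[OF assms] by (intro cylinder_component)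
  moreover have "component i \<psi> \<in> Con \<Sigma> (M i)"
    using i Spec_Con[OF assms] by (intro component_Con)
  ultimately show ?thesis
    using that[of i "component i \<psi>"] i assms cylinder_Spec_iff[of i "component i \<psi>"] by simp
qed

end

section \<open>Products of homomorphisms\<close>

lemma prod_map_morphism:
  assumes "\<And>i. i \<in> I \<Longrightarrow> morphism \<Sigma> (A i) (B i) (f i)"
  shows "morphism \<Sigma> (prod_algebra I A) (prod_algebra I B) (prod_map I f)"
  unfolding morphism_def
proof (intro conjI allI impI)
  show "prod_map I f \<in> carrier (prod_algebra I A) \<rightarrow> carrier (prod_algebra I B)"
    using morphism_carrier[OF assms] by (auto simp: prod_map_def PiE_iff)
  fix g as
  assume *: "\<Sigma> g = Some (length as) \<and> set as \<subseteq> carrier (prod_algebra I A)"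
  have "f i (oper (A i) g (map (\<lambda>x. x i) as)) = oper (B i) g (map (\<lambda>x. f i (x i)) as)" if "i \<in> I" for i
    using * that by (subst morphism_oper[OF assms[OF that]]) (auto simp: comp_def)
  then show "prod_map I f (oper (prod_algebra I A) g as)
    = oper (prod_algebra I B) g (map (prod_map I f) as)"
    by (auto simp: prod_map_def comp_def)
qed

text \<open>Coordinate \<open>i\<close> of the image depends on coordinate \<open>i\<close> of the
  argument alone, so preimages keep the index of a cylinder.\<close>

lemma pullback_cylinder:
  assumes "\<And>i. i \<in> I \<Longrightarrow> morphism \<Sigma> (A i) (B i) (f i)" "i \<in> I"
  shows "pullback (prod_algebra I A) (prod_map I f) (cylinder I B i \<psi>)
    = cylinder I A i (pullback (A i) (f i) \<psi>)"
  using assms morphism_carrier[OF prod_map_morphism[of I \<Sigma> A B f]]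
  by (auto simp: pullback_def prod_map_def simp del: prod_algebra_simps)
    (auto simp: PiE_iff)

locale perfect_modular_product_map =
  A: perfect_modular_product \<Sigma> E pair I A eA + B: perfect_modular_product \<Sigma> E pair I B eB
  for \<Sigma> :: "'f signature" and E :: "'f equations" and pair :: "'u \<Rightarrow> 'u \<Rightarrow> 'u" and I :: "'i set"
    and A :: "'i \<Rightarrow> ('f, 'a) algebra" and eA and B :: "'i \<Rightarrow> ('f, 'b) algebra" and eB +
  fixes f :: "'i \<Rightarrow> 'a \<Rightarrow> 'b"
  assumes morph: "\<And>i. i \<in> I \<Longrightarrow> morphism \<Sigma> (A i) (B i) (f i)"
begin

abbreviation Pf where "Pf \<equiv> prod_map I f"

lemma pull: "i \<in> I \<Longrightarrow> pullback A.PM Pf (cylinder I B i \<psi>) = cylinder I A i (pullback (A i) (f i) \<psi>)"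
  using morph by (rule pullback_cylinder)

lemma pull_Con: "i \<in> I \<Longrightarrow> \<psi> \<in> Con \<Sigma> (B i) \<Longrightarrow> pullback (A i) (f i) \<psi> \<in> Con \<Sigma> (A i)"
  using A.factor_algebra morph by (rule Con_pullback)

lemma cylinder_eqD:
  assumes "i \<in> I" "\<alpha> \<in> Con \<Sigma> (A i)" "\<beta> \<in> Con \<Sigma> (A i)" "cylinder I A i \<alpha> = cylinder I A i \<beta>"
  shows "\<alpha> = \<beta>"
proof -
  obtain z where "z \<in> carrier A.PM"
    by (rule A.PM_nonempty)
  then show ?thesis
    using assms cylinder_subset_iff[of z I A i] Con_subset_nabla by (metis subset_antisym subset_refl)
qed

lemma A_index_unique:
  assumes "i \<in> I" "j \<in> I" "\<alpha> \<in> Con \<Sigma> (A i)" "\<beta> \<in> Spec \<Sigma> (A j)" "cylinder I A i \<alpha> \<subseteq> cylinder I A j \<beta>"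
  shows "i = j"
  using A.PM_nonempty cylinder_index_unique[OF _ assms(1-3) Spec_Con[OF assms(4)] Spec_not_nabla[OF assms(4)] assms(5)]
  by metis

lemma B_index_unique:
  assumes "i \<in> I" "j \<in> I" "\<alpha> \<in> Con \<Sigma> (B i)" "\<beta> \<in> Spec \<Sigma> (B j)" "cylinder I B i \<alpha> \<subseteq> cylinder I B j \<beta>"
  shows "i = j"
  using B.PM_nonempty cylinder_index_unique[OF _ assms(1-3) Spec_Con[OF assms(4)] Spec_not_nabla[OF assms(4)] assms(5)]
  by metis

lemma B_cylinder_mono:
  assumes "i \<in> I" "\<alpha> \<in> Con \<Sigma> (B i)" "cylinder I B i \<alpha> \<subseteq> cylinder I B i \<beta>"
  shows "\<alpha> \<subseteq> \<beta>"
  using B.PM_nonempty cylinder_subset_iff[of _ I B i \<alpha> \<beta>] assms Con_subset_nabla by metis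

lemma A_cylinder_mono:
  assumes "i \<in> I" "\<alpha> \<in> Con \<Sigma> (A i)" "cylinder I A i \<alpha> \<subseteq> cylinder I A i \<beta>"
  shows "\<alpha> \<subseteq> \<beta>"
  using A.PM_nonempty cylinder_subset_iff[of _ I A i \<alpha> \<beta>] assms Con_subset_nabla by metis

text \<open>All primes of the products are cylinders over primes of factors, and preimages preserve
  the index.\<close>

lemma admissible_iff: "admissible \<Sigma> A.PM B.PM Pf \<longleftrightarrow> (\<forall>i\<in>I. admissible \<Sigma> (A i) (B i) (f i))"
proof
  assume adm: "admissible \<Sigma> A.PM B.PM Pf"
  show "\<forall>i\<in>I. admissible \<Sigma> (A i) (B i) (f i)"
    unfolding admissible_def
  proof (intro ballI)
    fix i \<psi>
    assume i: "i \<in> I" and \<psi>: "\<psi> \<in> Spec \<Sigma> (B i)"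
    then have "cylinder I B i \<psi> \<in> Spec \<Sigma> B.PM"
      by (simp add: B.cylinder_Spec_iff Spec_Con)
    then have "cylinder I A i (pullback (A i) (f i) \<psi>) \<in> Spec \<Sigma> A.PM"
      using adm by (simp add: admissible_def pull[OF i, symmetric])
    then show "pullback (A i) (f i) \<psi> \<in> Spec \<Sigma> (A i)"
      using i \<psi> by (simp add: A.cylinder_Spec_iff pull_Con Spec_Con)
  qed
next
  assume adm: "\<forall>i\<in>I. admissible \<Sigma> (A i) (B i) (f i)"
  show "admissible \<Sigma> A.PM B.PM Pf"
    unfolding admissible_def
  proof
    fix \<psi> assume "\<psi> \<in> Spec \<Sigma> B.PM"
    then obtain i \<phi> where i: "i \<in> I" "\<phi> \<in> Spec \<Sigma> (B i)" "\<psi> = cylinder I B i \<phi>"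
      by (rule B.Spec_cylinder)
    then show "pullback A.PM Pf \<psi> \<in> Spec \<Sigma> A.PM"
      using adm by (simp add: pull A.cylinder_Spec_iff pull_Con Spec_Con admissible_def)
  qed
qed

text \<open>Inclusion between cylinders over proper congruences forces equal indices, so each
  instance of going up lives in a single coordinate.\<close>

lemma going_up_iff: "going_up \<Sigma> A.PM B.PM Pf \<longleftrightarrow> (\<forall>i\<in>I. going_up \<Sigma> (A i) (B i) (f i))"
proof
  assume gu: "going_up \<Sigma> A.PM B.PM Pf"
  show "\<forall>i\<in>I. going_up \<Sigma> (A i) (B i) (f i)"
    unfolding going_up_def
  proof (intro ballI impI, elim conjE)
    fix i \<phi> \<psi> \<phi>\<^sub>1
    assume i: "i \<in> I" and sp: "\<phi> \<in> Spec \<Sigma> (A i)" "\<psi> \<in> Spec \<Sigma> (A i)" "\<phi>\<^sub>1 \<in> Spec \<Sigma> (B i)"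
      and le: "\<phi> \<subseteq> \<psi>" and eq: "pullback (A i) (f i) \<phi>\<^sub>1 = \<phi>"
    have "cylinder I A i \<phi> \<in> Spec \<Sigma> A.PM" "cylinder I A i \<psi> \<in> Spec \<Sigma> A.PM" "cylinder I B i \<phi>\<^sub>1 \<in> Spec \<Sigma> B.PM"
      using i sp by (simp_all add: A.cylinder_Spec_iff B.cylinder_Spec_iff Spec_Con)
    moreover have "cylinder I A i \<phi> \<subseteq> cylinder I A i \<psi>"
      using le by (auto simp: pullback_def)
    moreover have "pullback A.PM Pf (cylinder I B i \<phi>\<^sub>1) = cylinder I A i \<phi>"
      using i eq by (simp add: pull)
    ultimately obtain \<Psi> where \<Psi>: "\<Psi> \<in> Spec \<Sigma> B.PM" "cylinder I B i \<phi>\<^sub>1 \<subseteq> \<Psi>"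
      "pullback A.PM Pf \<Psi> = cylinder I A i \<psi>"
      using gu unfolding going_up_def by blast
    obtain j \<psi>\<^sub>1 where j: "j \<in> I" "\<psi>\<^sub>1 \<in> Spec \<Sigma> (B j)" "\<Psi> = cylinder I B j \<psi>\<^sub>1"
      using \<Psi>(1) by (rule B.Spec_cylinder)
    have ij: "i = j"
      using B_index_unique[OF i j(1) Spec_Con[OF sp(3)] j(2)] \<Psi>(2) j(3) by simp
    then have "\<phi>\<^sub>1 \<subseteq> \<psi>\<^sub>1"
      using B_cylinder_mono[OF i Spec_Con[OF sp(3)]] \<Psi>(2) j(3) by simp
    moreover have "pullback (A i) (f i) \<psi>\<^sub>1 = \<psi>"
      using i j(2,3) ij sp \<Psi>(3) by (intro cylinder_eqD[OF i]) (auto simp: pull pull_Con Spec_Con)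
    ultimately show "\<exists>\<psi>\<^sub>1\<in>Spec \<Sigma> (B i). \<phi>\<^sub>1 \<subseteq> \<psi>\<^sub>1 \<and> pullback (A i) (f i) \<psi>\<^sub>1 = \<psi>"
      using j(2) ij by blast
  qed
next
  assume gu: "\<forall>i\<in>I. going_up \<Sigma> (A i) (B i) (f i)"
  show "going_up \<Sigma> A.PM B.PM Pf"
    unfolding going_up_def
  proof (intro ballI impI, elim conjE)
    fix \<Phi> \<Psi> \<Phi>\<^sub>1
    assume sp: "\<Phi> \<in> Spec \<Sigma> A.PM" "\<Psi> \<in> Spec \<Sigma> A.PM" "\<Phi>\<^sub>1 \<in> Spec \<Sigma> B.PM"
      and le: "\<Phi> \<subseteq> \<Psi>" and eq: "pullback A.PM Pf \<Phi>\<^sub>1 = \<Phi>"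
    obtain i \<phi>\<^sub>1 where i: "i \<in> I" "\<phi>\<^sub>1 \<in> Spec \<Sigma> (B i)" "\<Phi>\<^sub>1 = cylinder I B i \<phi>\<^sub>1"
      using sp(3) by (rule B.Spec_cylinder)
    obtain j \<psi> where j: "j \<in> I" "\<psi> \<in> Spec \<Sigma> (A j)" "\<Psi> = cylinder I A j \<psi>"
      using sp(2) by (rule A.Spec_cylinder)
    let ?\<phi> = "pullback (A i) (f i) \<phi>\<^sub>1"
    have con: "?\<phi> \<in> Con \<Sigma> (A i)"
      using i by (intro pull_Con Spec_Con)
    \<comment> \<open>The description of \<Phi> is taken from \<open>\<Phi>\<^sub>1\<close>, so that
      both have the same index.\<close>
    have \<Phi>: "\<Phi> = cylinder I A i ?\<phi>"
      using eq i by (simp add: pull)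
    have ij: "i = j"
      using A_index_unique[OF i(1) j(1) con j(2)] le \<Phi> j(3) by simp
    have "?\<phi> \<subseteq> \<psi>"
      using A_cylinder_mono[OF i(1) con] le \<Phi> j(3) ij by simp
    moreover have "?\<phi> \<in> Spec \<Sigma> (A i)"
      using sp(1) \<Phi> i(1) con by (simp add: A.cylinder_Spec_iff)
    ultimately obtain \<psi>\<^sub>1 where \<psi>\<^sub>1: "\<psi>\<^sub>1 \<in> Spec \<Sigma> (B i)" "\<phi>\<^sub>1 \<subseteq> \<psi>\<^sub>1" "pullback (A i) (f i) \<psi>\<^sub>1 = \<psi>"
      using gu i j(2) ij unfolding going_up_def by blast
    have "cylinder I B i \<psi>\<^sub>1 \<in> Spec \<Sigma> B.PM"
      using i(1) \<psi>\<^sub>1(1) by (simp add: B.cylinder_Spec_iff Spec_Con)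
    moreover have "\<Phi>\<^sub>1 \<subseteq> cylinder I B i \<psi>\<^sub>1"
      using i(3) \<psi>\<^sub>1(2) by (auto simp: pullback_def)
    moreover have "pullback A.PM Pf (cylinder I B i \<psi>\<^sub>1) = \<Psi>"
      using i(1) \<psi>\<^sub>1(3) j(3) ij by (simp add: pull)
    ultimately show "\<exists>\<Psi>\<^sub>1\<in>Spec \<Sigma> B.PM. \<Phi>\<^sub>1 \<subseteq> \<Psi>\<^sub>1 \<and> pullback A.PM Pf \<Psi>\<^sub>1 = \<Psi>"
      by blast
  qed
qed

lemma Ker_subset_cylinder_iff:
  assumes i: "i \<in> I"
  shows "Ker A.PM B.PM Pf \<subseteq> cylinder I A i \<phi> \<longleftrightarrow> Ker (A i) (B i) (f i) \<subseteq> \<phi>"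
proof
  assume *: "Ker A.PM B.PM Pf \<subseteq> cylinder I A i \<phi>"
  show "Ker (A i) (B i) (f i) \<subseteq> \<phi>"
  proof
    fix w assume w: "w \<in> Ker (A i) (B i) (f i)"
    obtain a b where ab: "w = (a, b)"
      by fastforce
    obtain z where z: "z \<in> carrier A.PM"
      by (rule A.PM_nonempty)
    have upd: "z(i := a) \<in> carrier A.PM" "z(i := b) \<in> carrier A.PM"
      using w ab z i A.PM_update by (simp_all add: Ker_def pullback_iff del: prod_algebra_simps)
    \<comment> \<open>The two tuples agree off \<open>i\<close>, and \<open>f i\<close> identifies
      \<open>a\<close> with \<open>b\<close>.\<close>
    moreover have "Pf (z(i := a)) = Pf (z(i := b))"
      using w ab by (auto simp: Ker_def pullback_iff prod_map_def)
    ultimately have "(z(i := a), z(i := b)) \<in> Ker A.PM B.PM Pf"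
      using morphism_carrier[OF prod_map_morphism[of I \<Sigma> A B f]] morph
      by (simp add: Ker_def pullback_iff Id_on_iff del: prod_algebra_simps)
    then have "(z(i := a), z(i := b)) \<in> cylinder I A i \<phi>"
      using * by blast
    then show "w \<in> \<phi>"
      using ab by (simp add: pullback_iff)
  qed
next
  assume *: "Ker (A i) (B i) (f i) \<subseteq> \<phi>"
  show "Ker A.PM B.PM Pf \<subseteq> cylinder I A i \<phi>"
  proof
    fix w assume w: "w \<in> Ker A.PM B.PM Pf"
    obtain x y where xy: "w = (x, y)"
      by fastforce
    have cr: "x \<in> carrier A.PM" "y \<in> carrier A.PM" and "Pf x = Pf y"
      using w xy by (auto simp: Ker_def pullback_iff)
    then have "f i (x i) = f i (y i)"
      using i by (auto simp: prod_map_def dest: fun_cong[of _ _ i])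
    moreover have "x i \<in> carrier (A i)" "y i \<in> carrier (A i)"
      using cr i by auto
    ultimately have "(x i, y i) \<in> Ker (A i) (B i) (f i)"
      using morphism_carrier[OF morph[OF i]] by (simp add: Ker_def pullback_iff Id_on_iff)
    then show "w \<in> cylinder I A i \<phi>"
      using * cr xy by (auto simp: pullback_iff simp del: prod_algebra_simps)
  qed
qed

text \<open>The kernel condition restricts to one coordinate by
  \<open>Ker_subset_cylinder_iff\<close>. A prime of the target product whose preimage is a cylinder
  over a prime at \<open>i\<close> has index \<open>i\<close> itself.\<close>

lemma lying_over_iff: "lying_over \<Sigma> A.PM B.PM Pf \<longleftrightarrow> (\<forall>i\<in>I. lying_over \<Sigma> (A i) (B i) (f i))"
proof
  assume lo: "lying_over \<Sigma> A.PM B.PM Pf"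
  show "\<forall>i\<in>I. lying_over \<Sigma> (A i) (B i) (f i)"
    unfolding lying_over_def
  proof (intro ballI impI)
    fix i \<phi>
    assume i: "i \<in> I" and \<phi>: "\<phi> \<in> Spec \<Sigma> (A i)" and ker: "Ker (A i) (B i) (f i) \<subseteq> \<phi>"
    have "cylinder I A i \<phi> \<in> Spec \<Sigma> A.PM" "Ker A.PM B.PM Pf \<subseteq> cylinder I A i \<phi>"
      using i \<phi> ker by (simp_all add: A.cylinder_Spec_iff Spec_Con Ker_subset_cylinder_iff)
    then obtain \<Phi> where \<Phi>: "\<Phi> \<in> Spec \<Sigma> B.PM" "pullback A.PM Pf \<Phi> = cylinder I A i \<phi>"
      using lo unfolding lying_over_def by blast
    obtain j \<phi>\<^sub>1 where j: "j \<in> I" "\<phi>\<^sub>1 \<in> Spec \<Sigma> (B j)" "\<Phi> = cylinder I B j \<phi>\<^sub>1"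
      using \<Phi>(1) by (rule B.Spec_cylinder)
    have eq: "cylinder I A j (pullback (A j) (f j) \<phi>\<^sub>1) = cylinder I A i \<phi>"
      using \<Phi>(2) j by (simp add: pull)
    have con: "pullback (A j) (f j) \<phi>\<^sub>1 \<in> Con \<Sigma> (A j)"
      using j by (intro pull_Con Spec_Con)
    have ij: "j = i"
      using A_index_unique[OF j(1) i con \<phi>] eq by simp
    have "pullback (A i) (f i) \<phi>\<^sub>1 = \<phi>"
      using cylinder_eqD[OF i _ Spec_Con[OF \<phi>]] con eq ij by simp
    then show "\<exists>\<phi>\<^sub>1\<in>Spec \<Sigma> (B i). pullback (A i) (f i) \<phi>\<^sub>1 = \<phi>"
      using j ij by blast
  qed
next
  assume lo: "\<forall>i\<in>I. lying_over \<Sigma> (A i) (B i) (f i)"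
  show "lying_over \<Sigma> A.PM B.PM Pf"
    unfolding lying_over_def
  proof (intro ballI impI)
    fix \<Phi>
    assume \<Phi>: "\<Phi> \<in> Spec \<Sigma> A.PM" and ker: "Ker A.PM B.PM Pf \<subseteq> \<Phi>"
    obtain i \<phi> where i: "i \<in> I" "\<phi> \<in> Spec \<Sigma> (A i)" "\<Phi> = cylinder I A i \<phi>"
      using \<Phi> by (rule A.Spec_cylinder)
    obtain \<phi>\<^sub>1 where \<phi>\<^sub>1: "\<phi>\<^sub>1 \<in> Spec \<Sigma> (B i)" "pullback (A i) (f i) \<phi>\<^sub>1 = \<phi>"
      using lo ker i Ker_subset_cylinder_iff[OF i(1)] unfolding lying_over_def by blast
    have "cylinder I B i \<phi>\<^sub>1 \<in> Spec \<Sigma> B.PM"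
      using i(1) \<phi>\<^sub>1(1) by (simp add: B.cylinder_Spec_iff Spec_Con)
    moreover have "pullback A.PM Pf (cylinder I B i \<phi>\<^sub>1) = \<Phi>"
      using i \<phi>\<^sub>1(2) by (simp add: pull)
    ultimately show "\<exists>\<Phi>\<^sub>1\<in>Spec \<Sigma> B.PM. pullback A.PM Pf \<Phi>\<^sub>1 = \<Phi>"
      by blast
  qed
qed

end

section \<open>Coding tuples as terms\<close>

lemma inj_on_prod_trm:
  fixes h :: "'a \<Rightarrow> 'v"
  assumes "inj h"
  shows "inj_on (\<lambda>x. App undefined (map (\<lambda>i. Var (h (x i))) [1..<Suc n]))
    (carrier (prod_algebra {1..n} M))"
proof (rule inj_onI)
  fix x y
  assume x: "x \<in> carrier (prod_algebra {1..n} M)" and y: "y \<in> carrier (prod_algebra {1..n} M)"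
    and eq: "App undefined (map (\<lambda>i. Var (h (x i))) [1..<Suc n])
      = App undefined (map (\<lambda>i. Var (h (y i))) [1..<Suc n])"
  have "x i = y i" if "i \<in> {1..n}" for i
  proof -
    \<comment> \<open>\<open>[1..<Suc n]\<close> enumerates exactly \<open>{1..n}\<close>, so equal
      argument lists compare every coordinate.\<close>
    have "h (x i) = h (y i)"
      using eq that by (simp del: upt_Suc)
    then show ?thesis
      by (rule injD[OF assms])
  qed
  then show "x = y"
    using x y by (intro PiE_ext[of x "{1..n}" "\<lambda>i. carrier (M i)" y]) simp_all
qed

theorem corollary6p4:
  fixes \<Sigma> :: "'f signature"
    and E :: "'f equations"
    and n :: nat
    and A :: "nat \<Rightarrow> ('f, 'a) algebra"
    and B :: "nat \<Rightarrow> ('f, 'b) algebra"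
    and f :: "nat \<Rightarrow> 'a \<Rightarrow> 'b"
  defines "PA \<equiv> prod_algebra {1..n} A"
    and "PB \<equiv> prod_algebra {1..n} B"
    and "Pf \<equiv> prod_map {1..n} f"
  assumes "wf_equations \<Sigma> E"
    and "\<And>M :: ('f, ('f, 'a, 'b) universe) algebra.
           M \<in> equational_class \<Sigma> E \<Longrightarrow> Con_modular \<Sigma> M"
    and "\<And>M :: ('f, ('f, 'a, 'b) universe) algebra.
           M \<in> equational_class \<Sigma> E \<Longrightarrow> commutator \<Sigma> M (nabla M) (nabla M) = nabla M"
    and "n \<ge> 1"
    and "\<And>i. i \<in> {1..n} \<Longrightarrow> A i \<in> equational_class \<Sigma> E"
    and "\<And>i. i \<in> {1..n} \<Longrightarrow> B i \<in> equational_class \<Sigma> E"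
    and "\<And>i. i \<in> {1..n} \<Longrightarrow> morphism \<Sigma> (A i) (B i) (f i)"
  shows "(admissible \<Sigma> PA PB Pf \<longleftrightarrow> (\<forall>i\<in>{1..n}. admissible \<Sigma> (A i) (B i) (f i))) \<and>
    (admissible \<Sigma> PA PB Pf \<longrightarrow>
       (going_up \<Sigma> PA PB Pf \<longleftrightarrow> (\<forall>i\<in>{1..n}. going_up \<Sigma> (A i) (B i) (f i)))) \<and>
    (admissible \<Sigma> PA PB Pf \<longrightarrow>
       (lying_over \<Sigma> PA PB Pf \<longleftrightarrow> (\<forall>i\<in>{1..n}. lying_over \<Sigma> (A i) (B i) (f i))))"
proof -
  \<comment> \<open>Terms serve as data here: the head symbol is arbitrary, and injectivity comes
    from the constructors.\<close>
  define pair :: "('f, 'a, 'b) universe \<Rightarrow> ('f, 'a, 'b) universe \<Rightarrow> ('f, 'a, 'b) universe"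
    where "pair = (\<lambda>s t. App undefined [s, t])"
  \<comment> \<open>Elements of \<open>'a\<close> and of \<open>'b\<close> enter the universe as
    variables from their own summand of \<open>nat + 'a + 'b\<close>, and a tuple becomes a term
    listing its entries.\<close>
  interpret perfect_modular_product_map \<Sigma> E pair "{1..n}"
    A "\<lambda>x. App undefined (map (\<lambda>i. Var (Inr (Inl (x i)))) [1..<Suc n])"
    B "\<lambda>x. App undefined (map (\<lambda>i. Var (Inr (Inr (x i)))) [1..<Suc n])" f
  proof unfold_locales
    show "inj_on (\<lambda>x. App undefined (map (\<lambda>i. Var (Inr (Inl (x i)))) [1..<Suc n]) :: ('f, 'a, 'b) universe)
      (carrier (prod_algebra {1..n} A))"
      by (rule inj_on_prod_trm[of "\<lambda>a. Inr (Inl a)"]) (simp add: inj_def)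
    show "inj_on (\<lambda>x. App undefined (map (\<lambda>i. Var (Inr (Inr (x i)))) [1..<Suc n]) :: ('f, 'a, 'b) universe)
      (carrier (prod_algebra {1..n} B))"
      by (rule inj_on_prod_trm[of "\<lambda>b. Inr (Inr b)"]) (simp add: inj_def)
  qed (use assms(4-) in \<open>auto simp: pair_def\<close>)
  show ?thesis
    using admissible_iff going_up_iff lying_over_iff by (simp add: PA_def PB_def Pf_def)
qed

end
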